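(* Let $\mathbb{F}$ be a function field of one variable over a finite field $\mathbb{K}$ with $q$ elements, and let $\zeta_{\mathbb{F}}(s)$ be its zeta-function, viewed as a meromorphic function on $\mathbb{C}$. For each compact subset $K$ of $\mathbb{C}$, for each function $f\in\mathcal{O}(K)$, and for each $\epsilon>0$, there are finitely many complex values $a_k$, $b_k$ and $\lambda_k$, $k=1,\ldots,n$, such that $$\Big|f(s)-\sum_{k=1}^{n}\lambda_k\,\zeta_{\mathbb{F}}(a_k s+b_k)\Big|<\epsilon\quad\text{for } s\in K.$$
   Context: $\mathcal{O}(K)$ denotes the set of functions holomorphic on an open neighborhood (depending on the function) of $K$, two such functions being identified if they agree on some open neighborhood of $K$. Zeta-function. $\mathbb{K}$ is a finite field with $q$ elements; $\mathbb{F}$ is a function field of one variable over $\mathbb{K}$ (a finitely generated extension of $\mathbb{K}$ of transcendence degree $1$, equivalently the function field of a smooth, irreducible, projective algebraic curve over $\mathbb{K}$), with $\mathbb{K}$ as its full constant field, and $g$ denotes its genus. For $\Re s>1$, $$\zeta_{\mathbb{F}}(s)=\sum_{\alpha}\frac{1}{|\alpha|^{s}}=\prod_{p}\left(1-\frac{1}{|p|^{s}}\right)^{-1},$$ where $\alpha$ ranges over the positive (effective) divisors, $p$ over the prime divisors, and $|\alpha|=q^{\deg\alpha}$ is the absolute norm. With $u=q^{-s}$ one has $\zeta_{\mathbb{F}}(s)=Z(u)=\dfrac{L(u)}{(1-qu)(1-u)}$, where $L$ is a polynomial of degree $2g$ with $L(0)=1$; this defines the meromorphic continuation of $\zeta_{\mathbb{F}}$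 to $\mathbb{C}$. *)

theory Defs
  imports
    "HOL-Complex_Analysis.Complex_Analysis"
    "HOL-Computational_Algebra.Computational_Algebra"
    "HOL-Library.FuncSet"
begin

text \<open>
  The function field is the type \<^typ>\<open>'a\<close> of class \<^class>\<open>field\<close>; its field of constants
  is a subset \<open>k\<close> of that type.
\<close>

definition is_subring :: "'a::field set \<Rightarrow> bool" where
  "is_subring R \<longleftrightarrow> 0 \<in> R \<and> 1 \<in> R \<and>
     (\<forall>x\<in>R. \<forall>y\<in>R. x + y \<in> R \<and> x * y \<in> R) \<and> (\<forall>x\<in>R. - x \<in> R)"

definition is_subfield :: "'a::field set \<Rightarrow> bool" where
  "is_subfield k \<longleftrightarrow> is_subring k \<and> (\<forall>x\<in>k. inverse x \<in> k)"

definition algebraic_over :: "'a::field set \<Rightarrow> 'a \<Rightarrow> bool" where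
  "algebraic_over k x \<longleftrightarrow> (\<exists>p. p \<noteq> 0 \<and> (\<forall>i. coeff p i \<in> k) \<and> poly p x = 0)"

definition finitely_generated_over :: "'a::field set \<Rightarrow> bool" where
  "finitely_generated_over k \<longleftrightarrow> (\<exists>S. finite S \<and> is_subfield hull (k \<union> S) = UNIV)"

text \<open>Transcendence degree 1: some singleton is a transcendence basis.\<close>

definition transcendence_degree_one :: "'a::field set \<Rightarrow> bool" where
  "transcendence_degree_one k \<longleftrightarrow>
     (\<exists>x. \<not> algebraic_over k x \<and> (\<forall>y. algebraic_over (is_subfield hull (insert x k)) y))"

definition function_field_over_finite_field :: "'a::field set \<Rightarrow> bool" where
  "function_field_over_finite_field k \<longleftrightarrow>
     is_subfield k \<and> finite k \<and>
     finitely_generated_over k \<and> transcendence_degree_one k \<and>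
     (\<forall>y. algebraic_over k y \<longrightarrow> y \<in> k)"

text \<open>
  A prime divisor is identified with its valuation ring \<open>R\<close>, \<open>k \<subseteq> R \<subset> F\<close>.  In a function
  field of one variable every such ring is a discrete valuation ring, so discreteness is not
  part of the definition.
\<close>

definition prime_divisors :: "'a::field set \<Rightarrow> 'a set set" where
  "prime_divisors k =
     {R. is_subring R \<and> k \<subseteq> R \<and> R \<noteq> UNIV \<and> (\<forall>z. z \<in> R \<or> inverse z \<in> R)}"

definition maximal_ideal_of :: "'a::field set \<Rightarrow> 'a set" where
  "maximal_ideal_of R = {z \<in> R. z = 0 \<or> inverse z \<notin> R}"

text \<open>\<open>B\<close> is a system of representatives of a \<open>k\<close>-basis of the residue field of \<open>R\<close>.\<close>

definition residue_basis :: "'a::field set \<Rightarrow> 'a set \<Rightarrow> 'a set \<Rightarrow> bool" where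
  "residue_basis k R B \<longleftrightarrow> finite B \<and> B \<subseteq> R \<and>
     (\<forall>z\<in>R. \<exists>!c. c \<in> B \<rightarrow>\<^sub>E k \<and> z - (\<Sum>b\<in>B. c b * b) \<in> maximal_ideal_of R)"

definition prime_degree :: "'a::field set \<Rightarrow> 'a set \<Rightarrow> nat" where
  "prime_degree k R = (THE n. \<exists>B. residue_basis k R B \<and> card B = n)"

definition effective_divisors :: "'a::field set \<Rightarrow> ('a set \<Rightarrow> nat) set" where
  "effective_divisors k =
     {\<alpha>. finite {R. \<alpha> R \<noteq> 0} \<and> {R. \<alpha> R \<noteq> 0} \<subseteq> prime_divisors k}"

definition divisor_degree :: "'a::field set \<Rightarrow> ('a set \<Rightarrow> nat) \<Rightarrow> nat" where
  "divisor_degree k \<alpha> = (\<Sum>R | \<alpha> R \<noteq> 0. \<alpha> R * prime_degree k R)"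

definition absolute_norm :: "'a::field set \<Rightarrow> ('a set \<Rightarrow> nat) \<Rightarrow> nat" where
  "absolute_norm k \<alpha> = card k ^ divisor_degree k \<alpha>"

text \<open>
  \<open>\<zeta>\<close> is the Dirichlet series over the effective divisors for \<open>Re s > 1\<close>, continued to the
  plane by \<open>L(u) / ((1 - q u) (1 - u))\<close> with \<open>u = q powr (- s)\<close>.  The polynomial \<open>L\<close>, which has
  degree twice the genus, is determined by the series alone (see \<open>is_zeta_function_unique\<close>),
  so its degree is not prescribed here.  At a pole the quotient has the value 0 by the
  convention on division.
\<close>

definition is_zeta_function :: "'a::field set \<Rightarrow> (complex \<Rightarrow> complex) \<Rightarrow> bool" where
  "is_zeta_function k \<zeta> \<longleftrightarrow>
     (\<forall>s. Re s > 1 \<longrightarrow>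
        ((\<lambda>\<alpha>. 1 / of_nat (absolute_norm k \<alpha>) powr s) has_sum \<zeta> s) (effective_divisors k)) \<and>
     (\<exists>L :: complex poly. poly L 0 = 1 \<and>
        (\<forall>s. let q = of_nat (card k); u = q powr (- s)
             in \<zeta> s = poly L u / ((1 - q * u) * (1 - u))))"

lemma is_zeta_function_unique:
  assumes k: "function_field_over_finite_field k"
    and z: "is_zeta_function k \<zeta>" and z': "is_zeta_function k \<zeta>'"
  shows "\<zeta> = \<zeta>'"
proof -
  define q :: real where "q = real (card k)"
  have "{0, 1} \<subseteq> k" "finite k"
    using k by (auto simp: function_field_over_finite_field_def is_subfield_def is_subring_def)
  from card_mono[OF this(2,1)] have q: "q \<ge> 2"
    by (simp add: q_def)
  obtain L where L: "\<And>s. \<zeta> s = poly L (of_real q powr (- s)) /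
      ((1 - of_real q * of_real q powr (- s)) * (1 - of_real q powr (- s)))"
    using z by (auto simp: is_zeta_function_def Let_def q_def)
  obtain L' where L': "\<And>s. \<zeta>' s = poly L' (of_real q powr (- s)) /
      ((1 - of_real q * of_real q powr (- s)) * (1 - of_real q powr (- s)))"
    using z' by (auto simp: is_zeta_function_def Let_def q_def)
  define u :: "nat \<Rightarrow> complex" where "u n = of_real (q powr (- (real n + 2)))" for n
  have eq: "poly L (u n) = poly L' (u n)" for n
  proof -
    let ?s = "of_real (real n + 2) :: complex"
    have u: "of_real q powr (- ?s) = u n"
      using q powr_of_real[of q "- (real n + 2)"] by (simp add: u_def)
    have "Re ?s > 1"
      by simp
    then have "\<zeta> ?s = \<zeta>' ?s"
      using z z' unfolding is_zeta_function_def by (blast intro: has_sum_unique)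
    moreover have "q powr (- (real n + 2)) < q powr (- 1)" "q powr (- (real n + 2)) < q powr 0"
      using q by (intro powr_less_mono; simp)+
    then have "q * q powr (- (real n + 2)) < 1" "q powr (- (real n + 2)) < 1"
      using q by (simp_all add: powr_minus field_simps)
    then have "1 - of_real q * u n \<noteq> 0" "1 - u n \<noteq> 0"
      unfolding u_def of_real_mult[symmetric] by (auto simp flip: of_real_mult)
    ultimately show ?thesis
      using L[of ?s] L'[of ?s] unfolding u by auto
  qed
  have "inj u"
    using q by (auto simp: inj_def u_def powr_inj)
  then have "infinite (range u)"
    by (rule range_inj_infinite)
  moreover have "range u \<subseteq> {x. poly (L - L') x = 0}"
    using eq by auto
  ultimately have "L - L' = 0"
    using poly_roots_finite finite_subset by blast
  then show ?thesis
    using L L' by (auto simp: fun_eq_iff)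
qed

end

theory Submission imports Defs begin

text \<open>
  Near a simple pole \<open>z\<^sub>0\<close> with residue \<open>r\<close> the function \<open>(a / r) \<zeta>(z\<^sub>0 + a (s - w))\<close> tends to
  \<open>1 / (s - w)\<close> as \<open>a\<close> tends to 0, uniformly for \<open>s\<close> in a compact set not containing \<open>w\<close>.  Hence
  the theorem reduces to Runge's approximation of \<open>f\<close> by linear combinations of simple fractions
  with poles off \<open>K\<close>.

  It remains to see that \<open>\<zeta>\<close> has a pole at 0 or at 1.  Otherwise \<open>Z(u)\<close> would be a polynomial, so
  there would be no effective divisors of large degree.  But a prime divisor exists: a
  subring containing \<open>k\<close> and a transcendental \<open>x\<close>, and maximal among those without \<open>1/x\<close>, is a
  valuation ring; and its multiples have arbitrarily large degree.
\<close>

subsection \<open>Existence of prime divisors\<close>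

text \<open>An affine substitution carries the one pole \<open>z0\<close> to any point w off K, in
  whatever component of the complement; this is why K may be an arbitrary compact set. Since w is
  off K, the arguments of \<open>\<zeta>\<close> stay in a punctured neighbourhood of
  \<open>z0\<close>, so no summand is evaluated at a pole, where division would silently return 0. A
  zero of the denominator fails to be a pole only if L cancels the corresponding factor.
  Cancellation of both factors is refuted by counting: the coefficients of Z(u) are the numbers of
  effective divisors of each degree. The degree of a prime divisor is given by a definite
  description, so the value 0 has to be allowed for; then infinitely many divisors would share
  degree 0, which convergence of the series forbids.\<close>

lemma is_subring_minus: "is_subring R \<Longrightarrow> x \<in> R \<Longrightarrow> y \<in> R \<Longrightarrow> x - y \<in> R"
  unfolding is_subring_def by (metis add_uminus_conv_diff)

lemma is_subring_power: "is_subring R \<Longrightarrow> x \<in> R \<Longrightarrow> x ^ n \<in> R"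
  by (induction n) (auto simp: is_subring_def)

lemma is_subring_sum: "is_subring R \<Longrightarrow> (\<And>i. i \<in> I \<Longrightarrow> f i \<in> R) \<Longrightarrow> sum f I \<in> R"
  by (induction I rule: infinite_finite_induct) (auto simp: is_subring_def)

section \<open>Polynomials over a subring R and the ring R[z]\<close>

definition polys_over :: "'a::field set \<Rightarrow> 'a poly set" where
  "polys_over R = {p. \<forall>i. coeff p i \<in> R}"

lemma polys_over_0: "is_subring R \<Longrightarrow> 0 \<in> polys_over R"
  by (auto simp: polys_over_def is_subring_def)

lemma polys_over_pCons:
  "pCons c p \<in> polys_over R \<longleftrightarrow> c \<in> R \<and> p \<in> polys_over R"
proof -
  have "(\<forall>i. coeff (pCons c p) i \<in> R) \<longleftrightarrow> c \<in> R \<and> (\<forall>i. coeff p i \<in> R)"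
    by (metis coeff_pCons_0 coeff_pCons_Suc not0_implies_Suc)
  then show ?thesis by (simp add: polys_over_def)
qed

lemma polys_over_monom: "is_subring R \<Longrightarrow> c \<in> R \<Longrightarrow> monom c n \<in> polys_over R"
  by (auto simp: polys_over_def is_subring_def)

lemma polys_over_add:
  "is_subring R \<Longrightarrow> p \<in> polys_over R \<Longrightarrow> q \<in> polys_over R \<Longrightarrow> p + q \<in> polys_over R"
  by (auto simp: polys_over_def is_subring_def)

lemma polys_over_diff:
  "is_subring R \<Longrightarrow> p \<in> polys_over R \<Longrightarrow> q \<in> polys_over R \<Longrightarrow> p - q \<in> polys_over R"
  by (auto simp: polys_over_def intro: is_subring_minus)

lemma polys_over_mult:
  "is_subring R \<Longrightarrow> p \<in> polys_over R \<Longrightarrow> q \<in> polys_over R \<Longrightarrow> p * q \<in> polys_over R"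
  by (auto simp: polys_over_def coeff_mult is_subring_def intro!: is_subring_sum)

lemma poly_in_subring:
  assumes "is_subring R" "p \<in> polys_over R" "x \<in> R"
  shows "poly p x \<in> R"
proof -
  have "coeff p i * x ^ i \<in> R" for i
  proof -
    have "coeff p i \<in> R" using assms(2) by (simp add: polys_over_def)
    with is_subring_power[OF assms(1,3), of i] assms(1) show ?thesis
      unfolding is_subring_def by blast
  qed
  then show ?thesis unfolding poly_altdef by (intro is_subring_sum assms)
qed

definition adjoin :: "'a::field set \<Rightarrow> 'a \<Rightarrow> 'a set" where
  "adjoin R z = (\<lambda>p. poly p z) ` polys_over R"

lemma is_subring_adjoin:
  assumes "is_subring R"
  shows "is_subring (adjoin R z)"
proof -
  have 1: "1 \<in> R" using assms by (auto simp: is_subring_def)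
  note pc = polys_over_0[OF assms] polys_over_pCons[of _ _ R]
  have "poly 0 z \<in> adjoin R z" "poly [:1:] z \<in> adjoin R z"
    unfolding adjoin_def using pc 1 by blast+
  then have "0 \<in> adjoin R z" "1 \<in> adjoin R z" by simp_all
  moreover have "x + y \<in> adjoin R z \<and> x * y \<in> adjoin R z \<and> - x \<in> adjoin R z"
    if x: "x \<in> adjoin R z" and y: "y \<in> adjoin R z" for x y
  proof -
    obtain p q where p: "x = poly p z" "p \<in> polys_over R" and q: "y = poly q z" "q \<in> polys_over R"
      using x y by (auto simp: adjoin_def)
    have "poly (p + q) z \<in> adjoin R z" "poly (p * q) z \<in> adjoin R z" "poly (0 - p) z \<in> adjoin R z"
      unfolding adjoin_def using assms p q
      by (blast intro: polys_over_add polys_over_mult polys_over_diff polys_over_0)+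
    then show ?thesis using p q by simp
  qed
  ultimately show ?thesis by (auto simp: is_subring_def)
qed

lemma subset_adjoin:
  assumes "is_subring R" shows "R \<subseteq> adjoin R z"
proof
  fix x assume "x \<in> R"
  then have "poly [:x:] z \<in> adjoin R z"
    unfolding adjoin_def using polys_over_0[OF assms] polys_over_pCons by blast
  then show "x \<in> adjoin R z" by simp
qed

lemma self_in_adjoin:
  assumes "is_subring R" shows "z \<in> adjoin R z"
proof -
  have "poly (monom 1 1) z \<in> adjoin R z"
    unfolding adjoin_def using polys_over_monom[OF assms, of 1 1] assms
    by (auto simp: is_subring_def)
  then show ?thesis by (simp add: poly_monom)
qed

text \<open>The leading coefficient of \<open>p\<close> can be rewritten through \<open>q\<close> because the constant
  term \<open>1 - x * coeff q 0\<close> is a unit.\<close>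

lemma no_relations_in_both_extensions:
  fixes R :: "'a::field set"
  assumes R: "is_subring R" and x: "x \<in> R" "inverse x \<notin> R"
    and unit: "\<And>b. b \<in> R \<Longrightarrow> inverse (1 - x * b) \<in> R"
    and "z \<noteq> 0" "p \<in> polys_over R" "q \<in> polys_over R"
    and "x * poly p z = 1" "x * poly q (inverse z) = 1"
  shows False
  using assms(5-)
proof (induction "degree p + degree q" arbitrary: p q z rule: less_induct)
  case less
  have x0: "x \<noteq> 0" using less.prems by auto
  have deg0: False if r: "degree r = 0" "r \<in> polys_over R" "x * poly r y = 1" for r y
  proof -
    obtain c where c: "r = [:c:]" using degree_eq_zeroE[OF r(1)] by blast
    with r have "c \<in> R" "x * c = 1" by (auto simp: polys_over_pCons)
    then have "inverse x = c" using x0 by (simp add: field_simps)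
    with \<open>c \<in> R\<close> x show False by simp
  qed
  \<comment> \<open>The point y is arbitrary here so that the reduction serves twice: at z it lowers
    the degree of p, at 1/z that of q. Each use decreases the sum of the degrees.\<close>
  have reduce: "\<exists>r \<in> polys_over R. x * poly r y = 1 \<and> degree r < degree p"
    if y: "y \<noteq> 0" and p: "p \<in> polys_over R" "x * poly p y = 1"
      and q: "q \<in> polys_over R" "x * poly q (inverse y) = 1"
      and deg: "degree q \<le> degree p" "degree q > 0" for p q y
  proof -
    define n where "n = degree p"
    define m where "m = degree q"
    obtain b q' where q': "q = pCons b q'" by (cases q)
    have bq: "b \<in> R" "q' \<in> polys_over R" using q(1) by (auto simp: q' polys_over_pCons)
    define v where "v = inverse (1 - x * b)"
    have v: "v \<in> R" using unit bq v_def by simp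
    have nz: "1 - x * b \<noteq> 0"
    proof
      assume "1 - x * b = 0"
      then have "inverse x = b" using x0 by (simp add: field_simps)
      with bq x show False by simp
    qed
    have q'0: "q' \<noteq> 0" using deg(2) by (auto simp: q')
    then have dq': "m = Suc (degree q')" by (simp add: m_def q')
    \<comment> \<open>Moving the constant term of q to the right and dividing by the unit leaves a
      relation with only negative powers of y on the left.\<close>
    have rel: "x * v * inverse y * poly q' (inverse y) = 1"
    proof -
      have "x * (inverse y * poly q' (inverse y)) = 1 - x * b"
        using q(2) by (simp add: q' algebra_simps)
      then have "v * (x * (inverse y * poly q' (inverse y))) = 1"
        using nz by (simp add: v_def)
      then show ?thesis by (simp add: ac_simps)
    qed
    \<comment> \<open>Multiplying \<open>rel\<close> by y^n clears the denominators. The exponents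
      of 1/y run from 1 to m \<le> n, so y^n becomes x v h(y) with h of degree below n; this
      replaces the top power in p(y).\<close>
    define h where "h = monom (1::'a) (n - m) * reflect_poly q'"
    have "reflect_poly q' \<in> polys_over R"
      using bq(2) R by (auto simp: polys_over_def coeff_reflect_poly is_subring_def)
    then have h: "h \<in> polys_over R"
      using R by (auto simp: h_def is_subring_def intro!: polys_over_mult polys_over_monom)
    have hy: "x * v * poly h y = y ^ n"
    proof -
      have "poly (reflect_poly q') y = y ^ (m - 1) * poly q' (inverse y)"
        using y by (simp add: poly_reflect_poly_nz dq')
      then have "x * v * poly h y = (x * v * inverse y * poly q' (inverse y)) * y ^ (n - m + (m - 1) + 1)"
        using y by (simp add: h_def poly_monom power_add)
      also have "n - m + (m - 1) + 1 = n" using deg dq' by (simp add: n_def m_def)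
      finally show ?thesis using rel by simp
    qed
    have dh: "degree h < n"
    proof -
      have "degree h \<le> (n - m) + degree (reflect_poly q')"
        unfolding h_def using degree_mult_le degree_monom_le
        by (metis add.commute add_le_cancel_left order_trans)
      also have "\<dots> \<le> n - m + degree q'" using degree_reflect_poly_le[of q'] by simp
      also have "\<dots> < n" using deg dq' by (simp add: n_def m_def)
      finally show ?thesis .
    qed
    define c where "c = coeff p n"
    have c: "c \<in> R" using p by (simp add: polys_over_def c_def)
    define r where "r = p - monom c n + monom (c * x * v) 0 * h"
    have "r \<in> polys_over R"
      unfolding r_def using R p h c v x
      by (intro polys_over_add polys_over_diff polys_over_mult polys_over_monom) 
         (auto simp: is_subring_def)
    moreover have "poly r y = poly p y"
      using hy by (simp add: r_def poly_monom algebra_simps)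
    moreover have "degree r < n"
    proof -
      have n0: "n > 0" using deg by (simp add: n_def)
      have "coeff r i = 0" if "i \<ge> n" for i
      proof -
        have "coeff h i = 0" using that dh by (simp add: coeff_eq_0)
        then show ?thesis using that
          by (cases "i = n") (auto simp: r_def c_def n_def coeff_eq_0 monom_0)
      qed
      then show ?thesis using n0 by (metis degree_0 leading_coeff_0_iff leI)
    qed
    ultimately show ?thesis using p(2) unfolding n_def by metis
  qed
  show False
  proof (cases "degree q \<le> degree p")
    case True
    have "degree q > 0" using deg0[of q "inverse z"] less.prems by auto
    then obtain r where "r \<in> polys_over R" "x * poly r z = 1" "degree r < degree p"
      using reduce[of z p q] True less.prems by auto
    with less.hyps[of r q z] less.prems show False by simp
  next
    case False
    have "degree p > 0" using deg0[of p z] less.prems by auto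
    then obtain r where "r \<in> polys_over R" "x * poly r (inverse z) = 1" "degree r < degree q"
      using reduce[of "inverse z" q p] False less.prems by auto
    with less.hyps[of p r z] less.prems show False by simp
  qed
qed

text \<open>For y outside R, maximality puts 1/x into R[y], which is a relation x p(y) = 1 with p
  over R. With y = 1/(1 - x b) it follows that every 1 - x b is a unit of R; with y = z and y = 1/z
  one gets the two relations that exclude each other.\<close>

lemma valuation_ring_of_maximal_subring:
  fixes R :: "'a::field set"
  assumes R: "is_subring R" and x: "x \<in> R" "inverse x \<notin> R"
    and max: "\<And>S. is_subring S \<Longrightarrow> R \<subseteq> S \<Longrightarrow> inverse x \<notin> S \<Longrightarrow> S = R"
  shows "z \<in> R \<or> inverse z \<in> R"
proof (rule ccontr)
  assume neg: "\<not> ?thesis"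
  have 0: "0 \<in> R" "1 \<in> R" using R by (auto simp: is_subring_def)
  have z0: "z \<noteq> 0" using neg 0 by auto
  have x0: "x \<noteq> 0" using x by auto
  have adj: "inverse x \<in> adjoin R y" if "y \<notin> R" for y
    using max[OF is_subring_adjoin[OF R] subset_adjoin[OF R], of y] self_in_adjoin[OF R, of y] that
    by auto
  have rel: "\<exists>p \<in> polys_over R. x * poly p y = 1" if y: "y \<notin> R" for y
  proof -
    obtain p where "p \<in> polys_over R" "inverse x = poly p y"
      using adj[OF y] by (auto simp: adjoin_def)
    moreover from this have "x * poly p y = 1" using x0 by (simp flip: \<open>inverse x = poly p y\<close>)
    ultimately show ?thesis by blast
  qed
  have unit: "inverse (1 - x * b) \<in> R" if b: "b \<in> R" for b
  proof (rule ccontr)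
    assume "inverse (1 - x * b) \<notin> R"
    then obtain p where p: "p \<in> polys_over R" "x * poly p (inverse (1 - x * b)) = 1"
      using rel by blast
    define w where "w = 1 - x * b"
    have w: "w \<in> R" using R x b 0 by (auto simp: w_def is_subring_def intro!: is_subring_minus)
    have w0: "w \<noteq> 0"
    proof
      assume "w = 0"
      then have "inverse x = b" using x0 by (simp add: w_def field_simps)
      with b x show False by simp
    qed
    define d where "d = degree p"
    \<comment> \<open>Multiplied by w^d, the relation reads x g = w^d with g in R. As w is 1 modulo
      x R, so is w^d; hence 1 is a multiple of x in R.\<close>
    have "reflect_poly p \<in> polys_over R"
      using p(1) R by (auto simp: polys_over_def coeff_reflect_poly is_subring_def)
    then have g: "poly (reflect_poly p) w \<in> R"
      using poly_in_subring R w by blast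
    have "poly (reflect_poly p) w = w ^ d * poly p (inverse w)"
      using w0 by (simp add: poly_reflect_poly_nz d_def)
    then have e: "x * poly (reflect_poly p) w = w ^ d"
      using p(2) by (simp add: w_def mult.left_commute)
    have "\<exists>r\<in>R. w ^ n = 1 - x * r" for n
    proof (induction n)
      case 0 then show ?case using \<open>0 \<in> R\<close> by (intro bexI[of _ 0]) auto
    next
      case (Suc n)
      then obtain r where r: "r \<in> R" "w ^ n = 1 - x * r" by blast
      have "x * (b + w * r) = x * b + w * (1 - w ^ n)"
        using r(2) by (simp add: distrib_left mult.left_commute)
      then have "w ^ Suc n = 1 - x * (b + w * r)"
        by (simp add: right_diff_distrib) (simp add: w_def)
      moreover have "b + w * r \<in> R" using R b w r by (auto simp: is_subring_def)
      ultimately show ?case by blast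
    qed
    then obtain r where r: "r \<in> R" "w ^ d = 1 - x * r" by blast
    then have "inverse x = poly (reflect_poly p) w + r"
      using e x0 by (simp add: field_simps)
    then show False using g r x R by (auto simp: is_subring_def)
  qed
  obtain p q where "p \<in> polys_over R" "x * poly p z = 1"
    "q \<in> polys_over R" "x * poly q (inverse z) = 1"
    using rel neg by blast
  with no_relations_in_both_extensions[OF R x unit z0] show False by blast
qed

lemma prime_divisors_nonempty:
  fixes k :: "'a::field set"
  assumes k: "is_subring k" and x: "\<not> algebraic_over k x"
  shows "prime_divisors k \<noteq> {}"
proof -
  define \<A> where "\<A> = {R. is_subring R \<and> k \<subseteq> R \<and> x \<in> R \<and> inverse x \<notin> R}"
  have k0: "0 \<in> k" "1 \<in> k" using k by (auto simp: is_subring_def)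
  have x0: "x \<noteq> 0"
  proof
    assume "x = 0"
    then have "poly (monom 1 1) x = 0" by (simp add: poly_monom)
    moreover have "monom 1 1 \<in> polys_over k" using k k0 by (intro polys_over_monom)
    moreover have "monom 1 1 \<noteq> (0 :: 'a poly)" by simp
    ultimately show False using x unfolding algebraic_over_def polys_over_def by blast
  qed
  \<comment> \<open>If 1/x = p(x), then x is a root of X p - 1, whose constant term -1 shows that it
    is not the zero polynomial.\<close>
  have "inverse x \<notin> adjoin k x"
  proof
    assume "inverse x \<in> adjoin k x"
    then obtain p where p: "p \<in> polys_over k" "poly p x = inverse x" by (auto simp: adjoin_def)
    have "pCons (-1) p \<in> polys_over k"
      using k k0 p by (auto simp: polys_over_pCons is_subring_def)
    moreover have "poly (pCons (-1) p) x = 0" using p x0 by simp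
    moreover have "pCons (-1) p \<noteq> 0" by simp
    ultimately show False using x unfolding algebraic_over_def polys_over_def by blast
  qed
  then have "adjoin k x \<in> \<A>"
    using is_subring_adjoin[OF k] subset_adjoin[OF k] self_in_adjoin[OF k] by (simp add: \<A>_def)
  then have "\<A> \<noteq> {}" by blast
  moreover have "\<Union>C \<in> \<A>" if C: "C \<noteq> {}" "subset.chain \<A> C" for C
  proof -
    have CA: "R \<in> \<A>" if "R \<in> C" for R using C that by (auto simp: subset_chain_def)
    have tot: "\<exists>R\<in>C. y \<in> R \<and> z \<in> R" if yz: "y \<in> \<Union>C" "z \<in> \<Union>C" for y z
    proof -
      obtain R S where RS: "R \<in> C" "y \<in> R" "S \<in> C" "z \<in> S" using yz by blast
      then have "R \<subseteq> S \<or> S \<subseteq> R" using C(2) by (auto simp: subset_chain_def)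
      with RS show ?thesis by blast
    qed
    have ring: "is_subring R" if "R \<in> C" for R using CA[OF that] by (simp add: \<A>_def)
    obtain R0 where R0: "R0 \<in> C" using C(1) by blast
    have "is_subring (\<Union>C)"
      unfolding is_subring_def
    proof (intro conjI ballI)
      show "0 \<in> \<Union>C" "1 \<in> \<Union>C" using R0 ring[OF R0] by (auto simp: is_subring_def)
    next
      fix y assume "y \<in> \<Union>C"
      then obtain R where "R \<in> C" "y \<in> R" by blast
      with ring[of R] show "- y \<in> \<Union>C" by (auto simp: is_subring_def)
    next
      fix y z assume "y \<in> \<Union>C" "z \<in> \<Union>C"
      then obtain R where R: "R \<in> C" "y \<in> R" "z \<in> R" using tot by blast
      with ring[of R] have "y + z \<in> R" "y * z \<in> R" by (simp_all add: is_subring_def)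
      with R show "y + z \<in> \<Union>C" "y * z \<in> \<Union>C" by blast+
    qed
    moreover have "k \<subseteq> \<Union>C" "x \<in> \<Union>C" using R0 CA[OF R0] by (auto simp: \<A>_def)
    moreover have "inverse x \<notin> \<Union>C" using CA by (auto simp: \<A>_def)
    ultimately show ?thesis by (simp add: \<A>_def)
  qed
  ultimately have "\<exists>R\<in>\<A>. \<forall>S\<in>\<A>. R \<subseteq> S \<longrightarrow> S = R"
    by (rule subset_Zorn_nonempty)
  then obtain R where R: "R \<in> \<A>" "\<And>S. S \<in> \<A> \<Longrightarrow> R \<subseteq> S \<Longrightarrow> S = R"
    by blast
  have "z \<in> R \<or> inverse z \<in> R" for z
    using R by (intro valuation_ring_of_maximal_subring[of R x]) (auto simp: \<A>_def)
  then have "R \<in> prime_divisors k"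
    using R(1) by (auto simp: \<A>_def prime_divisors_def)
  then show ?thesis by blast
qed

subsection \<open>The numerator of the zeta function\<close>

text \<open>The point 0 is left out because u = q^(-s) never vanishes. Once the coefficients below n
  are known to be 0, dividing by x^n leaves a series that tends to \<open>a n\<close> at 0 and has
  sum 0 at all other points.\<close>

lemma powser_eq_0_coeff:
  fixes a :: "nat \<Rightarrow> complex"
  assumes r: "r > 0" and sums: "\<And>x. x \<noteq> 0 \<Longrightarrow> norm x < r \<Longrightarrow> (\<lambda>n. a n * x ^ n) sums 0"
  shows "a n = 0"
proof (induction n rule: less_induct)
  case (less n)
  have "(\<lambda>i. a (i + n) * x ^ i) sums 0" if x: "x \<noteq> 0" "norm x < r" for x
  proof -
    have "(\<lambda>i. a (i + n) * x ^ (i + n)) sums (0 - (\<Sum>i<n. a i * x ^ i))"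
      by (intro sums_split_initial_segment sums x)
    then have "(\<lambda>i. a (i + n) * x ^ (i + n)) sums 0" using less by simp
    from sums_mult2[OF this, of "inverse (x ^ n)"] show ?thesis
      using x by (simp add: power_add mult.assoc)
  qed
  then have "((\<lambda>_. 0) \<longlongrightarrow> a (0 + n)) (at (0 :: complex))"
    by (intro powser_limit_0_strong[OF r, of "\<lambda>i. a (i + n)"]) auto
  then show "a n = 0" by (simp add: tendsto_const_iff)
qed

text \<open>Grouping the sum by degree gives a power series in u that can be compared with P.
  Finiteness is a claim of its own, since \<open>card\<close> is 0 on infinite sets; an infinite
  fibre would sum a nonzero constant infinitely often.\<close>

lemma card_fibres_eq_coeff:
  fixes D :: "'b set" and deg :: "'b \<Rightarrow> nat" and P :: "complex poly"
  assumes r: "r > 0"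
    and sum: "\<And>u. u \<noteq> 0 \<Longrightarrow> norm u < r \<Longrightarrow> ((\<lambda>\<alpha>. u ^ deg \<alpha>) has_sum poly P u) D"
  shows "finite {\<alpha> \<in> D. deg \<alpha> = n}" and "of_nat (card {\<alpha> \<in> D. deg \<alpha> = n}) = coeff P n"
proof -
  let ?F = "\<lambda>n. {\<alpha> \<in> D. deg \<alpha> = n}"
  show fin: "finite (?F n)" for n
  proof (rule ccontr)
    assume inf: "infinite (?F n)"
    define u where "u = complex_of_real (r / 2)"
    have u: "u \<noteq> 0" "norm u < r" using r by (auto simp: u_def norm_divide)
    have "(\<lambda>\<alpha>. u ^ deg \<alpha>) summable_on D"
      using sum[OF u] by (auto simp: summable_on_def)
    then have "(\<lambda>\<alpha>. u ^ deg \<alpha>) summable_on ?F n"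
      by (rule summable_on_subset) auto
    then have "(\<lambda>\<alpha>. norm (u ^ deg \<alpha>)) summable_on ?F n"
      by (simp add: summable_on_iff_abs_summable_on_complex)
    then have "(\<lambda>\<alpha>. norm (u ^ n)) summable_on ?F n"
      by (rule summable_on_cong[THEN iffD1, rotated]) auto
    then show False using infsum_diverge_constant[OF inf, of "norm (u ^ n)"] u by simp
  qed
  define d where "d n = of_nat (card (?F n)) - coeff P n" for n
  have "(\<lambda>n. d n * u ^ n) sums 0" if u: "u \<noteq> 0" "norm u < r" for u
  proof -
    have "bij_betw snd (Sigma UNIV ?F) D"
      by (auto simp: bij_betw_def inj_on_def image_def)
    then have "((\<lambda>x. u ^ deg (snd x)) has_sum poly P u) (Sigma UNIV ?F)"
      using sum[OF u] by (subst has_sum_reindex_bij_betw)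
    moreover have "((\<lambda>\<alpha>. u ^ deg (snd (n, \<alpha>))) has_sum of_nat (card (?F n)) * u ^ n) (?F n)" for n
    proof -
      have "((\<lambda>_. u ^ n) has_sum of_nat (card (?F n)) * u ^ n) (?F n)"
        using fin by (rule has_sum_constant)
      then show ?thesis by (rule has_sum_cong[THEN iffD1, rotated]) auto
    qed
    ultimately have "((\<lambda>n. of_nat (card (?F n)) * u ^ n) has_sum poly P u) UNIV"
      by (rule has_sum_SigmaD)
    then have "(\<lambda>n. of_nat (card (?F n)) * u ^ n) sums poly P u"
      by (rule has_sum_imp_sums)
    moreover have "(\<lambda>n. coeff P n * u ^ n) sums poly P u"
      unfolding poly_altdef by (rule sums_finite) (auto simp: coeff_eq_0)
    ultimately have "(\<lambda>n. of_nat (card (?F n)) * u ^ n - coeff P n * u ^ n) sums (poly P u - poly P u)"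
      by (rule sums_diff)
    then show ?thesis by (simp add: d_def left_diff_distrib)
  qed
  then have "d n = 0" by (rule powser_eq_0_coeff[OF r])
  then show "of_nat (card (?F n)) = coeff P n" by (simp add: d_def)
qed

lemma multiple_of_prime_divisor:
  assumes "R \<in> prime_divisors k"
  defines "\<alpha> \<equiv> \<lambda>m S. if S = R then m else 0"
  shows "\<alpha> m \<in> effective_divisors k" and "divisor_degree k (\<alpha> m) = m * prime_degree k R"
proof -
  have supp: "{S. \<alpha> m S \<noteq> 0} = (if m = 0 then {} else {R})" by (auto simp: \<alpha>_def)
  show "\<alpha> m \<in> effective_divisors k"
    unfolding effective_divisors_def mem_Collect_eq supp using assms(1) by auto
  show "divisor_degree k (\<alpha> m) = m * prime_degree k R"
    unfolding divisor_degree_def supp by (simp add: \<alpha>_def)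
qed

lemma zeta_not_polynomial:
  assumes card: "card k \<ge> 2" and R: "R \<in> prime_divisors k" and \<zeta>: "is_zeta_function k \<zeta>"
  shows "\<not> (\<forall>s. Re s > 1 \<longrightarrow> \<zeta> s = poly P (of_nat (card k) powr (- s)))"
proof
  assume P: "\<forall>s. Re s > 1 \<longrightarrow> \<zeta> s = poly P (of_nat (card k) powr (- s))"
  define q :: real where "q = real (card k)"
  have q: "q \<ge> 2" using card by (simp add: q_def)
  then have lnq: "ln q > 0" by simp
  have sum: "((\<lambda>\<alpha>. u ^ divisor_degree k \<alpha>) has_sum poly P u) (effective_divisors k)"
    if u: "u \<noteq> 0" "norm u < 1 / q" for u
  proof -
    \<comment> \<open>This s solves q^(-s) = u. The half-plane Re s > 1 corresponds to the punctured
      disc of radius 1/q.\<close>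
    define s where "s = - Ln u / of_real (ln q)"
    have "ln (norm u) < ln (1 / q)" using u q by (subst ln_less_cancel_iff) auto
    then have "ln q < - ln (norm u)" using q by (simp add: ln_div)
    then have s: "Re s > 1" using lnq u by (simp add: s_def field_simps)
    have pow: "of_nat (card k ^ n) powr s = inverse u ^ n" for n
    proof -
      have pos: "real (card k ^ n) > 0" using card by simp
      have "Ln (of_nat (card k ^ n)) = of_real (ln (real (card k ^ n)))"
        using Ln_of_real[OF pos] by simp
      also have "ln (real (card k ^ n)) = real n * ln q"
        using q by (simp add: q_def ln_realpow)
      finally have "of_nat (card k ^ n) powr s = exp (of_nat n * (s * of_real (ln q)))"
        using pos by (simp add: powr_def mult_ac)
      also have "s * of_real (ln q) = - Ln u" using lnq by (simp add: s_def)
      also have "exp (of_nat n * (- Ln u)) = inverse u ^ n"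
        using u by (simp add: exp_of_nat_mult exp_minus power_inverse)
      finally show ?thesis .
    qed
    have "of_nat (card k) powr (- s) = u"
      using pow[of 1] u by (simp add: powr_minus)
    then have zs: "\<zeta> s = poly P u" using P s by simp
    have "1 / of_nat (absolute_norm k \<alpha>) powr s = u ^ divisor_degree k \<alpha>" for \<alpha>
      unfolding absolute_norm_def pow by (simp add: power_inverse divide_inverse)
    moreover have "((\<lambda>\<alpha>. 1 / of_nat (absolute_norm k \<alpha>) powr s) has_sum \<zeta> s) (effective_divisors k)"
      using \<zeta> s unfolding is_zeta_function_def by blast
    ultimately show ?thesis unfolding zs by presburger
  qed
  have "1 / q > 0" using q by simp
  note A = card_fibres_eq_coeff[OF this sum]
  define d where "d = prime_degree k R"
  define \<alpha> where "\<alpha> m S = (if S = R then m else 0)" for m :: nat and S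
  have \<alpha>: "\<alpha> m \<in> effective_divisors k" "divisor_degree k (\<alpha> m) = m * d" for m
    using multiple_of_prime_divisor[OF R, of m] by (simp_all add: \<alpha>_def[abs_def] d_def)
  \<comment> \<open>If d = 0, all multiples of R lie in the fibre of degree 0, which is finite.
    Otherwise degree P + 1 times R has degree beyond that of P, where the fibre is empty.\<close>
  show False
  proof (cases "d = 0")
    case True
    have "inj \<alpha>" unfolding \<alpha>_def by (rule injI) (metis (full_types))
    then have "infinite (range \<alpha>)" by (rule range_inj_infinite)
    moreover have "range \<alpha> \<subseteq> {\<alpha> \<in> effective_divisors k. divisor_degree k \<alpha> = 0}"
      using \<alpha> True by auto
    ultimately show False using A(1)[of 0] finite_subset by blast
  next
    case False
    define n where "n = Suc (degree P) * d"
    have "n > degree P" using False by (cases d) (simp_all add: n_def)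
    then have "card {\<alpha> \<in> effective_divisors k. divisor_degree k \<alpha> = n} = 0"
      using A(2)[of n] by (simp add: coeff_eq_0)
    moreover have "\<alpha> (Suc (degree P)) \<in> {\<alpha> \<in> effective_divisors k. divisor_degree k \<alpha> = n}"
      using \<alpha> by (simp add: n_def)
    moreover have "finite {\<alpha> \<in> effective_divisors k. divisor_degree k \<alpha> = n}" by (rule A(1))
    ultimately show False unfolding card_eq_0_iff by blast
  qed
qed

lemma norm_powr_uminus_less:
  assumes "q > 1" "Re s > 1"
  shows "norm (complex_of_real q powr (- s)) < 1 / q"
proof -
  have "norm (complex_of_real q powr (- s)) = q powr (- Re s)"
    using assms by (simp add: norm_powr_real_powr)
  also have "\<dots> < q powr (- 1)" using assms by (intro powr_less_mono) auto
  finally show ?thesis using assms by (simp add: powr_minus_divide)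
qed

text \<open>The points 1/q and 1 are the zeros in u of the denominator, reached at s = 1 and s = 0.
  If L vanished at both, the two linear factors would cancel and leave a polynomial in u.\<close>

lemma zeta_numerator_nonzero:
  assumes card: "card k \<ge> 2" and R: "R \<in> prime_divisors k" and \<zeta>: "is_zeta_function k \<zeta>"
    and L: "\<And>s. let q = of_nat (card k); u = q powr (- s)
             in \<zeta> s = poly L u / ((1 - q * u) * (1 - u))"
  shows "poly L (1 / of_nat (card k)) \<noteq> 0 \<or> poly L 1 \<noteq> 0"
proof (rule ccontr)
  assume neg: "\<not> ?thesis"
  define q where "q = real (card k)"
  have q: "q \<ge> 2" using card by (simp add: q_def)
  have L0: "poly L (1 / of_real q) = 0" "poly L 1 = 0"
    using neg by (simp_all add: q_def)
  obtain L1 where L1: "L = [:- 1, 1:] * L1"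
    using L0(2) unfolding poly_eq_0_iff_dvd by (auto elim: dvdE)
  have "poly L1 (1 / of_real q) = 0" 
  proof -
    have "poly L (1 / of_real q) = (1 / of_real q - 1) * poly L1 (1 / of_real q)"
      by (simp add: L1 algebra_simps)
    then have "(1 / of_real q - 1) * poly L1 (1 / of_real q) = 0" using L0(1) by (simp only:)
    moreover have "1 / of_real q \<noteq> (1 :: complex)" using q by simp
    ultimately show ?thesis unfolding mult_eq_0_iff right_minus_eq by blast
  qed
  then obtain L2 where L2: "L1 = [:- (1 / of_real q), 1:] * L2"
    unfolding poly_eq_0_iff_dvd by (auto elim: dvdE)
  \<comment> \<open>The factor 1/q comes from 1 - q u = q (1/q - u); the sign changes of the two
    linear factors cancel each other.\<close>
  have "\<zeta> s = poly (smult (1 / of_real q) L2) (of_nat (card k) powr (- s))" if s: "Re s > 1" for s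
  proof -
    define u where "u = complex_of_real q powr (- s)"
    have u: "norm u < 1 / q" using norm_powr_uminus_less[of q s] q s by (simp add: u_def)
    have "u \<noteq> 1 / of_real q" using u q by (auto simp: norm_divide)
    moreover have "u \<noteq> 1"
    proof
      assume "u = 1"
      with u have "1 < 1 / q" by simp
      with q show False by (simp add: field_simps)
    qed
    moreover have "\<zeta> s = poly L u / ((1 - of_real q * u) * (1 - u))"
      using L[of s] by (simp add: Let_def u_def q_def)
    moreover have "poly L u = (u - 1) * ((u - 1 / of_real q) * poly L2 u)"
    proof -
      have "poly [:- 1, 1:] u = u - 1" "poly [:- (1 / of_real q), 1:] u = u - 1 / of_real q"
        by simp_all
      then show ?thesis by (simp only: L1 L2 poly_mult)
    qed
    moreover have "1 - of_real q * u = of_real q * (1 / of_real q - u)"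
      using q by (simp add: field_simps)
    ultimately have "\<zeta> s = (u - 1) * ((u - 1 / of_real q) * poly L2 u) /
        (of_real q * (1 / of_real q - u) * (1 - u))" by simp
    also have "\<dots> = 1 / of_real q * poly L2 u"
    proof -
      have *: "(- y) * ((- x) * c) / (r * x * y) = 1 / r * c"
        if "x \<noteq> 0" "y \<noteq> 0" for x y c r :: complex
        using that by simp
      show ?thesis
        using *[of "1 / of_real q - u" "1 - u" "poly L2 u" "of_real q"]
          \<open>u \<noteq> 1 / of_real q\<close> \<open>u \<noteq> 1\<close> by (simp only: minus_diff_eq) auto
    qed
    finally show ?thesis by (simp add: u_def q_def)
  qed
  with zeta_not_polynomial[OF card R \<zeta>] show False by blast
qed

subsection \<open>Simple poles\<close>

text \<open>For small \<open>a\<close>, the points a (s - w) with s in K fill part of a small disc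
  around 0 but miss 0 itself. \<open>P\<close> is carried along because the same \<open>a\<close>
  must also keep the arguments away from the poles.\<close>

lemma approximate_simple_fraction:
  fixes \<phi> :: "complex \<Rightarrow> complex"
  assumes lim: "((\<lambda>t. t * \<phi> (z0 + t)) \<longlongrightarrow> r) (at 0)" and r: "r \<noteq> 0"
    and good: "eventually P (at z0)"
    and K: "compact K" and w: "w \<notin> K" and e: "\<epsilon> > 0"
  shows "\<exists>a b l. \<forall>s\<in>K. P (a * s + b) \<and> norm (1 / (s - w) - l * \<phi> (a * s + b)) < \<epsilon>"
proof -
  obtain d where d: "d > 0" "\<And>s. s \<in> K \<Longrightarrow> d \<le> norm (s - w)"
    using separate_point_closed[OF compact_imp_closed[OF K] w] by (metis dist_commute dist_norm)
  obtain B where B: "B > 0" "\<And>s. s \<in> K \<Longrightarrow> norm (s - w) \<le> B"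
  proof -
    have "bounded ((\<lambda>s. s - w) ` K)"
      using K by (intro compact_imp_bounded compact_continuous_image continuous_intros)
    then show ?thesis using that unfolding bounded_pos by blast
  qed
  \<comment> \<open>The tolerance \<epsilon> d absorbs the later division by s - w, whose modulus is
    at least d.\<close>
  have "eventually (\<lambda>t. norm (t * \<phi> (z0 + t) / r - 1) < \<epsilon> * d) (at 0)"
  proof -
    have "((\<lambda>t. t * \<phi> (z0 + t) / r) \<longlongrightarrow> r / r) (at 0)" by (intro tendsto_intros lim r)
    then have "((\<lambda>t. t * \<phi> (z0 + t) / r) \<longlongrightarrow> 1) (at 0)" using r by simp
    then show ?thesis using e d(1) by (auto simp: tendsto_iff dist_norm)
  qed
  moreover have "eventually (\<lambda>t. P (z0 + t)) (at 0)"
    using good by (subst (asm) at_to_0) (simp add: eventually_filtermap add.commute)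
  ultimately have "eventually (\<lambda>t. norm (t * \<phi> (z0 + t) / r - 1) < \<epsilon> * d \<and> P (z0 + t)) (at 0)"
    by (rule eventually_conj)
  then obtain \<delta> where \<delta>: "\<delta> > 0"
    "\<And>t. t \<noteq> 0 \<Longrightarrow> norm t < \<delta> \<Longrightarrow> norm (t * \<phi> (z0 + t) / r - 1) < \<epsilon> * d \<and> P (z0 + t)"
    by (auto simp: eventually_at dist_norm)
  \<comment> \<open>Since |s - w| \<le> B on K, this gives |a (s - w)| \<le> \<delta>/2 <
    \<delta>.\<close>
  define a where "a = complex_of_real (\<delta> / (2 * B))"
  have a: "a \<noteq> 0" using \<delta> B by (simp add: a_def)
  show ?thesis
  proof (rule exI[of _ a], rule exI[of _ "z0 - a * w"], rule exI[of _ "a / r"], rule ballI)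
    fix s assume s: "s \<in> K"
    define t where "t = a * (s - w)"
    have sw: "s - w \<noteq> 0" using s w by auto
    have t0: "t \<noteq> 0" using a sw by (simp add: t_def)
    have "norm t \<le> norm a * B" using B(2)[OF s] by (simp add: t_def norm_mult mult_left_mono)
    also have "\<dots> < \<delta>" using \<delta> B by (simp add: a_def norm_divide norm_mult)
    finally have t: "norm (t * \<phi> (z0 + t) / r - 1) < \<epsilon> * d" "P (z0 + t)" using \<delta>(2) t0 by auto
    have arg: "a * s + (z0 - a * w) = z0 + t" by (simp add: t_def algebra_simps)
    have "a / r * \<phi> (z0 + t) = t * \<phi> (z0 + t) / r / (s - w)"
      using sw by (simp add: t_def)
    then have "1 / (s - w) - a / r * \<phi> (z0 + t) = - (t * \<phi> (z0 + t) / r - 1) / (s - w)"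
      by (simp add: diff_divide_distrib)
    then have "norm (1 / (s - w) - a / r * \<phi> (z0 + t)) = norm (t * \<phi> (z0 + t) / r - 1) / norm (s - w)"
      by (simp only: norm_divide norm_minus_cancel)
    also have "\<dots> < \<epsilon> * d / norm (s - w)" using t(1) sw by (intro divide_strict_right_mono) auto
    also have "\<dots> \<le> \<epsilon>" using d(2)[OF s] e sw by (simp add: field_simps)
    finally show "P (a * s + (z0 - a * w)) \<and>
        norm (1 / (s - w) - a / r * \<phi> (a * s + (z0 - a * w))) < \<epsilon>"
      using t(2) by (simp add: arg)
  qed
qed

lemma isCont_imp_not_pole:
  fixes \<phi> :: "complex \<Rightarrow> complex"
  assumes "isCont \<phi> z"
  shows "\<not> is_pole \<phi> z"
  using assms not_tendsto_and_filterlim_at_infinity[of "at z" \<phi>]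
  by (auto simp: is_pole_def isCont_def)

lemma simple_pole_of_quotient:
  fixes G H \<phi> :: "complex \<Rightarrow> complex"
  assumes \<phi>: "\<And>s. \<phi> s = G s / H s" and G: "\<And>s. isCont G s" and H: "\<And>s. isCont H s"
    and H0: "H z0 = 0" and H': "(H has_field_derivative c) (at z0)" "c \<noteq> 0" and G0: "G z0 \<noteq> 0"
  shows "((\<lambda>t. t * \<phi> (z0 + t)) \<longlongrightarrow> G z0 / c) (at 0)"
    and "eventually (\<lambda>z. \<not> is_pole \<phi> z) (at z0)"
proof -
  have Hq: "((\<lambda>t. H (z0 + t) / t) \<longlongrightarrow> c) (at 0)"
    using H'(1) H0 by (simp add: DERIV_def)
  have "((\<lambda>t. G (z0 + t)) \<longlongrightarrow> G z0) (at 0)"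
    using G[of z0] by (simp add: isCont_iff)
  then have "((\<lambda>t. G (z0 + t) / (H (z0 + t) / t)) \<longlongrightarrow> G z0 / c) (at 0)"
    by (intro tendsto_intros Hq H')
  then show "((\<lambda>t. t * \<phi> (z0 + t)) \<longlongrightarrow> G z0 / c) (at 0)"
    by (simp add: \<phi> mult.commute)
  \<comment> \<open>The limit of the difference quotient also shows that \<open>z0\<close> is an
    isolated zero of H, so \<phi> is continuous at all other points near \<open>z0\<close>.\<close>
  have "eventually (\<lambda>t. H (z0 + t) / t \<noteq> 0) (at 0)"
    using tendsto_imp_eventually_ne[OF Hq H'(2)] .
  then have "eventually (\<lambda>t. H (t + z0) \<noteq> 0) (at 0)"
    by eventually_elim (auto simp: add.commute)
  then have "eventually (\<lambda>z. H z \<noteq> 0) (at z0)"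
    by (subst at_to_0) (simp add: eventually_filtermap)
  then show "eventually (\<lambda>z. \<not> is_pole \<phi> z) (at z0)"
  proof eventually_elim
    case (elim z)
    then have "isCont (\<lambda>s. G s / H s) z" using G H by (intro continuous_intros) auto
    moreover have "\<phi> = (\<lambda>s. G s / H s)" using \<phi> by auto
    ultimately show ?case using isCont_imp_not_pole by blast
  qed
qed

lemma zeta_simple_pole:
  assumes k: "function_field_over_finite_field k" and \<zeta>: "is_zeta_function k \<zeta>"
  obtains z0 r where "((\<lambda>t. t * \<zeta> (z0 + t)) \<longlongrightarrow> r) (at 0)" "r \<noteq> 0"
    "eventually (\<lambda>z. \<not> is_pole \<zeta> z) (at z0)"
proof -
  have sub: "is_subring k" "finite k"
    using k by (auto simp: function_field_over_finite_field_def is_subfield_def)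
  then have "card {0, 1 :: 'a} \<le> card k"
    by (intro card_mono) (auto simp: is_subring_def)
  then have card: "card k \<ge> 2" by simp
  obtain x where "\<not> algebraic_over k x"
    using k unfolding function_field_over_finite_field_def transcendence_degree_one_def by blast
  then obtain R where R: "R \<in> prime_divisors k"
    using prime_divisors_nonempty[OF sub(1)] by blast
  obtain L where L: "\<And>s. let q = of_nat (card k); u = q powr (- s)
      in \<zeta> s = poly L u / ((1 - q * u) * (1 - u))"
    using \<zeta> unfolding is_zeta_function_def by blast
  define q where "q = real (card k)"
  \<comment> \<open>With c = ln q one has u = q^(-s) = exp(- s c), hence u' = - c u.\<close>
  define c where "c = complex_of_real (ln q)"
  have q: "q \<ge> 2" using card by (simp add: q_def)
  have c: "c \<noteq> 0" using q by (simp add: c_def)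
  define u where "u s = exp (- s * c)" for s
  define G where "G s = poly L (u s)" for s
  define H where "H s = (1 - of_real q * u s) * (1 - u s)" for s
  have "of_nat (card k) powr (- s) = u s" for s
  proof -
    have "of_nat (card k) = complex_of_real q" by (simp add: q_def)
    moreover have "complex_of_real q powr (- s) = u s"
      using q Ln_of_real[of q] by (simp add: powr_def u_def c_def)
    ultimately show ?thesis by simp
  qed
  then have quot: "\<zeta> s = G s / H s" for s
    using L[of s] by (simp add: Let_def G_def H_def q_def)
  have contu: "isCont u s" for s unfolding u_def[abs_def] by (intro continuous_intros)
  have contG: "isCont G s" for s unfolding G_def[abs_def] by (intro continuous_intros contu)
  have contH: "isCont H s" for s unfolding H_def[abs_def] by (intro continuous_intros contu)
  have derivH: "(H has_field_derivative c * u s * (of_real q * (1 - u s) + (1 - of_real q * u s))) (at s)" for s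
    unfolding H_def u_def by (auto intro!: derivative_eq_intros simp: algebra_simps)
  note witness = that
  have pole: thesis if z0: "H z0 = 0" "c * u z0 * (of_real q * (1 - u z0) + (1 - of_real q * u z0)) \<noteq> 0" "G z0 \<noteq> 0" for z0
  proof (rule witness)
    note * = simple_pole_of_quotient[OF quot contG contH \<open>H z0 = 0\<close> derivH _ \<open>G z0 \<noteq> 0\<close>]
    show "((\<lambda>t. t * \<zeta> (z0 + t)) \<longlongrightarrow> G z0 / (c * u z0 * (of_real q * (1 - u z0) + (1 - of_real q * u z0)))) (at 0)"
      "eventually (\<lambda>z. \<not> is_pole \<zeta> z) (at z0)"
      using *[OF z0(2)] by blast+
    show "G z0 / (c * u z0 * (of_real q * (1 - u z0) + (1 - of_real q * u z0))) \<noteq> 0"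
      using z0 by simp
  qed
  have u0: "u 0 = 1" by (simp add: u_def)
  have u1: "u 1 = 1 / of_real q"
    using q by (simp add: u_def c_def exp_minus exp_of_real inverse_eq_divide)
  \<comment> \<open>Since q \<noteq> 1, only the factor 1 - q u of H vanishes at s = 1 and only 1 -
    u at s = 0; both zeros are therefore simple.\<close>
  have q1: "complex_of_real q \<noteq> 1" "complex_of_real q \<noteq> 0" using q by auto
  from zeta_numerator_nonzero[OF card R \<zeta> L] show thesis
  proof
    assume "poly L (1 / of_nat (card k)) \<noteq> 0"
    then show thesis using c q1 by (intro pole[of 1]) (simp_all add: G_def H_def u1 q_def)
  next
    assume "poly L 1 \<noteq> 0"
    then show thesis using c q1 by (intro pole[of 0]) (simp_all add: G_def H_def u0)
  qed
qed

subsection \<open>Runge approximation\<close>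

text \<open>The closure, in the uniform norm on K, of the linear span of B. Combinations are lists
  of pairs, so that sums become concatenations and a function may occur repeatedly.\<close>

definition uniform_span :: "complex set \<Rightarrow> (complex \<Rightarrow> complex) set \<Rightarrow> (complex \<Rightarrow> complex) set" where
  "uniform_span K B = {g. \<forall>\<epsilon>>0. \<exists>xs. snd ` set xs \<subseteq> B \<and>
     (\<forall>s\<in>K. norm (g s - (\<Sum>(c, b)\<leftarrow>xs. c * b s)) < \<epsilon>)}"

lemma uniform_span_base: "b \<in> B \<Longrightarrow> b \<in> uniform_span K B"
  unfolding uniform_span_def by (auto intro!: exI[of _ "[(1, b)]"])

lemma uniform_span_zero: "(\<lambda>_. 0) \<in> uniform_span K B"
  unfolding uniform_span_def by (auto intro!: exI[of _ "[]"])

lemma uniform_span_add: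
  assumes "g \<in> uniform_span K B" "h \<in> uniform_span K B"
  shows "(\<lambda>s. g s + h s) \<in> uniform_span K B"
  unfolding uniform_span_def mem_Collect_eq
proof (intro allI impI)
  fix \<epsilon> :: real assume "\<epsilon> > 0"
  then have "\<epsilon> / 2 > 0" by simp
  then obtain xs ys where xs: "snd ` set xs \<subseteq> B" "\<forall>s\<in>K. norm (g s - (\<Sum>(c, b)\<leftarrow>xs. c * b s)) < \<epsilon> / 2"
    and ys: "snd ` set ys \<subseteq> B" "\<forall>s\<in>K. norm (h s - (\<Sum>(c, b)\<leftarrow>ys. c * b s)) < \<epsilon> / 2"
    using assms unfolding uniform_span_def by blast
  show "\<exists>xs. snd ` set xs \<subseteq> B \<and> (\<forall>s\<in>K. norm (g s + h s - (\<Sum>(c, b)\<leftarrow>xs. c * b s)) < \<epsilon>)"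
  proof (intro exI[of _ "xs @ ys"] conjI ballI)
    show "snd ` set (xs @ ys) \<subseteq> B" using xs(1) ys(1) by auto
    fix s assume "s \<in> K"
    then have "norm (g s - (\<Sum>(c, b)\<leftarrow>xs. c * b s)) + norm (h s - (\<Sum>(c, b)\<leftarrow>ys. c * b s)) < \<epsilon> / 2 + \<epsilon> / 2"
      using xs(2) ys(2) by (intro add_strict_mono) auto
    from norm_diff_triangle_ineq[of "g s" "h s", THEN le_less_trans, OF this]
    show "norm (g s + h s - (\<Sum>(c, b)\<leftarrow>xs @ ys. c * b s)) < \<epsilon>"
      by simp
  qed
qed

lemma uniform_span_cmult:
  assumes "g \<in> uniform_span K B"
  shows "(\<lambda>s. c * g s) \<in> uniform_span K B"
proof (cases "c = 0")
  case False
  show ?thesis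
    unfolding uniform_span_def mem_Collect_eq
  proof (intro allI impI)
    fix \<epsilon> :: real assume "\<epsilon> > 0"
    then have "\<epsilon> / norm c > 0" using False by simp
    then obtain xs where xs: "snd ` set xs \<subseteq> B" "\<forall>s\<in>K. norm (g s - (\<Sum>(c, b)\<leftarrow>xs. c * b s)) < \<epsilon> / norm c"
      using assms unfolding uniform_span_def by blast
    let ?ys = "map (\<lambda>(d, b). (c * d, b)) xs"
    have sum: "(\<Sum>(d, b)\<leftarrow>?ys. d * b s) = c * (\<Sum>(d, b)\<leftarrow>xs. d * b s)" for s
      by (simp add: sum_list_const_mult[symmetric] o_def case_prod_beta mult.assoc)
    show "\<exists>ys. snd ` set ys \<subseteq> B \<and> (\<forall>s\<in>K. norm (c * g s - (\<Sum>(c, b)\<leftarrow>ys. c * b s)) < \<epsilon>)"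
    proof (intro exI[of _ ?ys] conjI ballI)
      show "snd ` set ?ys \<subseteq> B" using xs(1) by force
      fix s assume "s \<in> K"
      then show "norm (c * g s - (\<Sum>(c, b)\<leftarrow>?ys. c * b s)) < \<epsilon>"
        using xs(2) False unfolding sum right_diff_distrib[symmetric] norm_mult
        by (simp add: field_simps)
    qed
  qed
qed (simp add: uniform_span_zero)

lemma uniform_span_sum:
  "(\<And>i. i \<in> I \<Longrightarrow> g i \<in> uniform_span K B) \<Longrightarrow> (\<lambda>s. \<Sum>i\<in>I. g i s) \<in> uniform_span K B"
  by (induction I rule: infinite_finite_induct) (auto simp: uniform_span_zero uniform_span_add)

lemma uniform_span_limit:
  assumes "\<And>\<epsilon>. \<epsilon> > 0 \<Longrightarrow> \<exists>h\<in>uniform_span K B. \<forall>s\<in>K. norm (g s - h s) < \<epsilon>"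
  shows "g \<in> uniform_span K B"
  unfolding uniform_span_def mem_Collect_eq
proof (intro allI impI)
  fix \<epsilon> :: real assume "\<epsilon> > 0"
  then have e: "\<epsilon> / 2 > 0" by simp
  from assms[OF this] obtain h where h: "h \<in> uniform_span K B" "\<forall>s\<in>K. norm (g s - h s) < \<epsilon> / 2"
    by blast
  then obtain xs where xs: "snd ` set xs \<subseteq> B" "\<forall>s\<in>K. norm (h s - (\<Sum>(c, b)\<leftarrow>xs. c * b s)) < \<epsilon> / 2"
    using e unfolding uniform_span_def by blast
  show "\<exists>xs. snd ` set xs \<subseteq> B \<and> (\<forall>s\<in>K. norm (g s - (\<Sum>(c, b)\<leftarrow>xs. c * b s)) < \<epsilon>)"
  proof (intro exI[of _ xs] conjI ballI xs)
    fix s assume s: "s \<in> K"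
    show "norm (g s - (\<Sum>(c, b)\<leftarrow>xs. c * b s)) < \<epsilon>"
      by (rule norm_diff_triangle_less[of _ "h s" "\<epsilon> / 2" _ "\<epsilon> / 2", simplified])
        (use h xs s in auto)
  qed
qed

text \<open>The mesh enters through an explicit oscillation bound, so that one N can serve a whole
  family of integrands, namely all s in K at once. Each subinterval contributes at most
  \<epsilon>/N, and these errors add up to \<epsilon>.\<close>

lemma riemann_sum_bound:
  fixes g :: "real \<Rightarrow> complex"
  assumes g: "continuous_on {0..1} g" and N: "N > 0"
    and osc: "\<And>t t'. t \<in> {0..1} \<Longrightarrow> t' \<in> {0..1} \<Longrightarrow> \<bar>t - t'\<bar> \<le> 1 / real N \<Longrightarrow> norm (g t - g t') \<le> \<epsilon>"
  shows "norm (integral {0..1} g - (\<Sum>i<N. 1 / of_nat N * g (real i / real N))) \<le> \<epsilon>"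
proof -
  have "norm (integral {0..real n / N} g - (\<Sum>i<n. 1 / of_nat N * g (real i / real N))) \<le> real n * (\<epsilon> / N)"
    if "n \<le> N" for n
    using that
  proof (induction n)
    case (Suc n)
    let ?a = "real n / N" and ?b = "real (Suc n) / N"
    have ab: "0 \<le> ?a" "?a \<le> ?b" "?b \<le> 1" "?b - ?a = 1 / N"
      using Suc.prems N by (auto simp: field_simps)
    have cont: "continuous_on {?a..?b} g" "continuous_on {0..?b} g"
      using ab(1,3) by (meson atLeastatMost_subset_iff continuous_on_subset g order_refl)+
    have "integral {0..?b} g = integral {0..?a} g + integral {?a..?b} g"
      using ab cont by (intro Henstock_Kurzweil_Integration.integral_combine[symmetric]
          integrable_continuous_real) auto
    moreover have "integral {?a..?b} g - 1 / of_nat N * g ?a = integral {?a..?b} (\<lambda>t. g t - g ?a)"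
    proof -
      have "integral {?a..?b} (\<lambda>t. g t - g ?a) = integral {?a..?b} g - integral {?a..?b} (\<lambda>t. g ?a)"
        using cont by (intro integral_diff integrable_continuous_real) auto
      also have "integral {?a..?b} (\<lambda>t. g ?a) = 1 / of_nat N * g ?a"
        using ab by (simp add: scaleR_conv_of_real)
      finally show ?thesis by simp
    qed
    moreover have "norm (integral {?a..?b} (\<lambda>t. g t - g ?a)) \<le> \<epsilon> * (?b - ?a)"
    proof (rule integral_bound)
      show "continuous_on {?a..?b} (\<lambda>t. g t - g ?a)" using cont by (intro continuous_intros)
      show "norm (g t - g ?a) \<le> \<epsilon>" if "t \<in> {?a..?b}" for t
      proof (rule osc)
        have t: "?a \<le> t" "t \<le> ?b" using that by auto
        then have "0 \<le> t" "t \<le> 1" using ab by linarith+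
        then show "t \<in> {0..1}" by simp
        have "?a \<le> 1" using ab by linarith
        then show "?a \<in> {0..1}" using ab(1) by simp
        show "\<bar>t - ?a\<bar> \<le> 1 / real N" using t ab by linarith
      qed
    qed (use ab in auto)
    ultimately have "norm ((integral {0..?a} g - (\<Sum>i<n. 1 / of_nat N * g (real i / real N))) +
        (integral {?a..?b} g - 1 / of_nat N * g ?a)) \<le> real n * (\<epsilon> / N) + \<epsilon> / N"
      using Suc ab by (intro norm_triangle_mono) auto
    moreover have "(integral {0..?a} g - (\<Sum>i<n. 1 / of_nat N * g (real i / real N))) +
        (integral {?a..?b} g - 1 / of_nat N * g ?a) =
        integral {0..?b} g - (\<Sum>i<Suc n. 1 / of_nat N * g (real i / real N))"
      using \<open>integral {0..?b} g = _\<close> by simp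
    ultimately show ?case by (simp only: of_nat_Suc distrib_right mult_1_left add.commute)
  qed auto
  from this[of N] show ?thesis using N by simp
qed

text \<open>As a function of s, a Riemann sum of this integral is a combination of kernels 1/(s - w)
  with w on the segment, hence off K. Uniform continuity of the integrand on the compact set [0,1] x
  K makes the approximation uniform in s.\<close>

lemma cauchy_line_integral_in_uniform_span:
  assumes K: "compact K" and f: "continuous_on (closed_segment a b) f"
    and disj: "closed_segment a b \<inter> K = {}"
    and kernel: "\<And>w. w \<notin> K \<Longrightarrow> (\<lambda>s. 1 / (s - w)) \<in> uniform_span K B"
  shows "(\<lambda>s. contour_integral (linepath a b) (\<lambda>w. f w / (w - s))) \<in> uniform_span K B"
proof (rule uniform_span_limit)
  fix \<epsilon> :: real assume \<epsilon>: "\<epsilon> > 0"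
  define \<gamma> where "\<gamma> = linepath a b"
  define F where "F t s = f (\<gamma> t) / (\<gamma> t - s) * (b - a)" for t s
  have \<gamma>: "\<gamma> t \<in> closed_segment a b" if "t \<in> {0..1}" for t
    using that linepath_in_path[of t a b] by (simp add: \<gamma>_def)
  have f\<gamma>: "continuous_on {0..1} (\<lambda>t. f (\<gamma> t))"
    by (rule continuous_on_compose2[OF f]) (use \<gamma> in \<open>auto simp: \<gamma>_def intro: continuous_on_linepath\<close>)
  have "continuous_on ({0..1} \<times> K) (\<lambda>(t, s). F t s)"
    unfolding F_def case_prod_beta
  proof (intro continuous_intros ballI)
    show "continuous_on ({0..1} \<times> K) (\<lambda>x. f (\<gamma> (fst x)))"
      by (rule continuous_on_compose2[OF f\<gamma>]) (auto intro: continuous_intros)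
    show "continuous_on ({0..1} \<times> K) (\<lambda>x. \<gamma> (fst x))"
      unfolding \<gamma>_def linepath_def by (intro continuous_intros)
    show "\<gamma> (fst x) - snd x \<noteq> 0" if "x \<in> {0..1} \<times> K" for x
      using \<gamma>[of "fst x"] that disj by auto
  qed
  then have "uniformly_continuous_on ({0..1} \<times> K) (\<lambda>(t, s). F t s)"
    using K by (intro compact_uniformly_continuous compact_Times) auto
  moreover have "\<epsilon> / 2 > 0" using \<epsilon> by simp
  ultimately obtain \<delta> where \<delta>: "\<delta> > 0" "\<And>x x'. x \<in> {0..1} \<times> K \<Longrightarrow> x' \<in> {0..1} \<times> K \<Longrightarrow>
      dist x' x < \<delta> \<Longrightarrow> dist ((\<lambda>(t, s). F t s) x') ((\<lambda>(t, s). F t s) x) < \<epsilon> / 2"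
    unfolding uniformly_continuous_on_def by metis
  obtain N where N: "N > 0" "1 / real N < \<delta>"
    using \<delta>(1) by (metis reals_Archimedean inverse_eq_divide zero_less_Suc)
  define h where "h s = (\<Sum>i<N. 1 / of_nat N * F (real i / real N) s)" for s
  show "\<exists>h\<in>uniform_span K B.
      \<forall>s\<in>K. norm (contour_integral (linepath a b) (\<lambda>w. f w / (w - s)) - h s) < \<epsilon>"
  proof (intro bexI[of _ h] ballI)
    fix s assume s: "s \<in> K"
    have cont: "continuous_on {0..1} (\<lambda>t. F t s)"
      unfolding F_def using f\<gamma>
    proof (intro continuous_intros ballI)
      show "continuous_on {0..1} \<gamma>"
        unfolding \<gamma>_def by (rule continuous_on_linepath)
      show "\<gamma> t - s \<noteq> 0" if "t \<in> {0..1}" for t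
        using \<gamma>[OF that] disj s by auto
    qed
    have "norm (F t s - F t' s) \<le> \<epsilon> / 2"
      if "t \<in> {0..1}" "t' \<in> {0..1}" "\<bar>t - t'\<bar> \<le> 1 / real N" for t t'
      using \<delta>(2)[of "(t', s)" "(t, s)"] that s N(2) by (simp add: dist_Pair_Pair dist_norm)
    from riemann_sum_bound[OF cont N(1) this]
    have "norm (integral {0..1} (\<lambda>t. F t s) - h s) \<le> \<epsilon> / 2" by (simp add: h_def)
    moreover have "contour_integral (linepath a b) (\<lambda>w. f w / (w - s)) = integral {0..1} (\<lambda>t. F t s)"
      by (simp add: contour_integral_integral F_def \<gamma>_def)
    ultimately show "norm (contour_integral (linepath a b) (\<lambda>w. f w / (w - s)) - h s) < \<epsilon>"
      using \<epsilon> by simp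
  next
    have "(\<lambda>s. 1 / of_nat N * F t s) \<in> uniform_span K B" if t: "t \<in> {0..1}" for t
    proof -
      have "\<gamma> t \<notin> K" using \<gamma>[OF t] disj by auto
      \<comment> \<open>The minus sign turns 1/(s - \<gamma> t) into the factor 1/(\<gamma> t - s)
        of the integrand.\<close>
      from uniform_span_cmult[OF kernel[OF this], of "- (f (\<gamma> t) * (b - a) / of_nat N)"]
      moreover have "- (f (\<gamma> t) * (b - a) / of_nat N) * (1 / (s - \<gamma> t)) = 1 / of_nat N * F t s" for s
      proof -
        have "1 / (s - \<gamma> t) = - (1 / (\<gamma> t - s))" using minus_divide_right[of 1 "\<gamma> t - s"] by simp
        then show ?thesis by (simp only: F_def) (simp add: mult_ac)
      qed
      ultimately show ?thesis by simp
    qed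
    then show "h \<in> uniform_span K B"
      unfolding h_def[abs_def] using N by (intro uniform_span_sum) (auto simp: field_simps)
  qed
qed

lemma isCont_cauchy_line_integral:
  assumes f: "continuous_on (closed_segment a b) f" and s: "s \<notin> closed_segment a b"
  shows "isCont (\<lambda>s. contour_integral (linepath a b) (\<lambda>w. f w / (w - s))) s"
proof -
  have "((\<lambda>u. f u / (u - w) ^ 1) has_contour_integral
      contour_integral (linepath a b) (\<lambda>u. f u / (u - w))) (linepath a b)"
    if "w \<in> UNIV - path_image (linepath a b)" for w
    using that f unfolding power_one_right
    by (intro has_contour_integral_integral contour_integrable_continuous_linepath continuous_intros) auto
  \<comment> \<open>Differentiation under the integral sign; \<open>norm (b - a)\<close> is the
    constant speed of \<open>linepath a b\<close>.\<close>
  from Cauchy_next_derivative(2)[OF _ _ this, where w = s and B = "norm (b - a)"]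
  show ?thesis using f s by (intro DERIV_isCont) auto
qed

text \<open>The cancellation of inner edges as pure algebra: h x stands for the integral over an
  edge of the square x, and h (\<sigma> x) for that over the opposite edge, which belongs to the
  neighbour \<sigma> x as well. If both squares are in S, the coefficient of the common edge is
  0.\<close>

lemma sum_diff_shift:
  fixes h :: "'i \<Rightarrow> complex"
  assumes "finite S" "inj \<sigma>"
  shows "(\<Sum>x\<in>S. h x - h (\<sigma> x)) = (\<Sum>x\<in>S \<union> \<sigma> ` S. (of_bool (x \<in> S) - of_bool (x \<in> \<sigma> ` S)) * h x)"
proof -
  have "(\<Sum>x\<in>T. h x) = (\<Sum>x\<in>S \<union> \<sigma> ` S. of_bool (x \<in> T) * h x)" if "T \<subseteq> S \<union> \<sigma> ` S" for T
    using that assms by (intro sum.mono_neutral_cong_left) auto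
  moreover have "(\<Sum>x\<in>S. h (\<sigma> x)) = (\<Sum>x\<in>\<sigma> ` S. h x)"
    using assms by (subst sum.reindex) (auto intro: inj_on_subset)
  ultimately show ?thesis by (simp add: sum_subtractf left_diff_distrib)
qed

section \<open>A square grid in the plane\<close>

definition grid_point :: "real \<Rightarrow> int \<times> int \<Rightarrow> complex" where
  "grid_point \<delta> x = Complex (\<delta> * of_int (fst x)) (\<delta> * of_int (snd x))"

definition right_of :: "int \<times> int \<Rightarrow> int \<times> int" where
  "right_of x = (fst x + 1, snd x)"

definition top_of :: "int \<times> int \<Rightarrow> int \<times> int" where
  "top_of x = (fst x, snd x + 1)"

text \<open>Squares are indexed by their lower left corner. They are closed, so they cover the plane
  and a point on an edge lies in both adjacent squares.\<close>

definition grid_square :: "real \<Rightarrow> int \<times> int \<Rightarrow> complex set" where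
  "grid_square \<delta> x = cbox (grid_point \<delta> x) (grid_point \<delta> (right_of (top_of x)))"

lemmas grid_defs = grid_point_def right_of_def top_of_def

lemma inj_right_of: "inj right_of" and inj_top_of: "inj top_of"
  by (auto simp: inj_def right_of_def top_of_def prod_eq_iff)

lemma convex_grid_square: "convex (grid_square \<delta> x)"
  by (simp add: grid_square_def)

lemma mem_grid_square:
  "z \<in> grid_square \<delta> x \<longleftrightarrow>
     \<delta> * fst x \<le> Re z \<and> Re z \<le> \<delta> * (fst x + 1) \<and> \<delta> * snd x \<le> Im z \<and> Im z \<le> \<delta> * (snd x + 1)"
  by (auto simp: grid_square_def grid_defs in_cbox_complex_iff)

lemma grid_edges_subset_square:
  assumes "\<delta> > 0"
  shows "closed_segment (grid_point \<delta> x) (grid_point \<delta> (right_of x)) \<subseteq> grid_square \<delta> x"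
    and "closed_segment (grid_point \<delta> (top_of x)) (grid_point \<delta> (right_of (top_of x))) \<subseteq> grid_square \<delta> x"
    and "closed_segment (grid_point \<delta> x) (grid_point \<delta> (top_of x)) \<subseteq> grid_square \<delta> x"
    and "closed_segment (grid_point \<delta> (right_of x)) (grid_point \<delta> (top_of (right_of x))) \<subseteq> grid_square \<delta> x"
  using assms
  by (intro closed_segment_subset convex_grid_square; simp add: mem_grid_square grid_defs mult_left_mono)+

lemma grid_square_exists:
  assumes "\<delta> > 0"
  shows "\<exists>x. z \<in> grid_square \<delta> x"
proof -
  have "\<delta> * \<lfloor>t / \<delta>\<rfloor> \<le> t \<and> t \<le> \<delta> * (\<lfloor>t / \<delta>\<rfloor> + 1)" for t
  proof -
    have "\<delta> * \<lfloor>t / \<delta>\<rfloor> \<le> \<delta> * (t / \<delta>)" "\<delta> * (t / \<delta>) \<le> \<delta> * (\<lfloor>t / \<delta>\<rfloor> + 1)"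
      using assms by (intro mult_left_mono; linarith)+
    then show ?thesis using assms by simp
  qed
  then have "z \<in> grid_square \<delta> (\<lfloor>Re z / \<delta>\<rfloor>, \<lfloor>Im z / \<delta>\<rfloor>)"
    by (simp add: mem_grid_square)
  then show ?thesis by blast
qed

lemma finite_grid_squares_meeting:
  assumes "\<delta> > 0" "bounded K"
  shows "finite {x. grid_square \<delta> x \<inter> K \<noteq> {}}"
proof -
  obtain M where M: "\<And>z. z \<in> K \<Longrightarrow> norm z \<le> M"
    using assms(2) by (auto simp: bounded_iff)
  \<comment> \<open>The summand 1 allows for a lower left corner up to one cell to the left of or
    below the points of K in its square.\<close>
  define b where "b = \<lceil>M / \<delta>\<rceil> + 1"
  have "x \<in> {- b..b} \<times> {- b..b}" if x: "grid_square \<delta> x \<inter> K \<noteq> {}" for x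
  proof -
    obtain z where z: "z \<in> grid_square \<delta> x" "z \<in> K" using x by blast
    have bound: "m \<in> {- b..b}" if "\<delta> * of_int m \<le> t" "t \<le> \<delta> * (of_int m + 1)" "\<bar>t\<bar> \<le> M" for m :: int and t
    proof -
      have "\<delta> * of_int m \<le> M" "- M \<le> \<delta> * (of_int m + 1)" using that by auto
      then have "of_int m \<le> M / \<delta>" "- (M / \<delta>) \<le> of_int m + 1"
        using assms(1) by (simp_all add: field_simps)
      then show ?thesis unfolding b_def by (auto) linarith+
    qed
    have "\<bar>Re z\<bar> \<le> M" "\<bar>Im z\<bar> \<le> M"
      using M[OF z(2)] abs_Re_le_cmod[of z] abs_Im_le_cmod[of z] by linarith+
    then have "fst x \<in> {- b..b}" "snd x \<in> {- b..b}"
      using z(1) by (auto simp: mem_grid_square intro!: bound simp del: atLeastAtMost_iff)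
    then show ?thesis by (simp add: mem_Times_iff)
  qed
  then have "{x. grid_square \<delta> x \<inter> K \<noteq> {}} \<subseteq> {- b..b} \<times> {- b..b}" by blast
  then show ?thesis by (rule finite_subset) simp
qed

text \<open>All edges are oriented to the right or upwards, so the top and left edges enter the
  counterclockwise boundary with a minus sign. The right-hand side has the differences to which
  \<open>sum_diff_shift\<close> applies.\<close>

lemma contour_integral_grid_square:
  assumes "\<delta> > 0" and g: "continuous_on (path_image (rectpath (grid_point \<delta> x) (grid_point \<delta> (right_of (top_of x))))) g"
  defines "h \<equiv> \<lambda>x. contour_integral (linepath (grid_point \<delta> x) (grid_point \<delta> (right_of x))) g"
    and "v \<equiv> \<lambda>x. contour_integral (linepath (grid_point \<delta> x) (grid_point \<delta> (top_of x))) g"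
  shows "contour_integral (rectpath (grid_point \<delta> x) (grid_point \<delta> (right_of (top_of x)))) g =
    (h x - h (top_of x)) - (v x - v (right_of x))"
proof -
  define a b c d where "a = grid_point \<delta> x" "b = grid_point \<delta> (right_of x)"
    "c = grid_point \<delta> (right_of (top_of x))" "d = grid_point \<delta> (top_of x)"
  note abcd = this
  have rect: "rectpath a c = linepath a b +++ linepath b c +++ linepath c d +++ linepath d a"
    by (simp add: rectpath_def Let_def abcd grid_defs)
  have "continuous_on (closed_segment a b \<union> closed_segment b c \<union> closed_segment c d \<union> closed_segment d a) g"
    using g unfolding abcd[symmetric] rect by (simp add: path_image_join Un_assoc)
  then have int: "g contour_integrable_on linepath a b" "g contour_integrable_on linepath b c"
    "g contour_integrable_on linepath c d" "g contour_integrable_on linepath d a"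
    by (auto intro!: contour_integrable_continuous_linepath elim: continuous_on_subset)
  have rev: "contour_integral (linepath y z) g = - contour_integral (linepath z y) g" for y z
    using contour_integral_reversepath[of "linepath z y" g] by simp
  have "contour_integral (rectpath a c) g =
      contour_integral (linepath a b) g + contour_integral (linepath b c) g
      + contour_integral (linepath c d) g + contour_integral (linepath d a) g"
    unfolding rect using int by (simp add: contour_integrable_join)
  also have "\<dots> = contour_integral (linepath a b) g + contour_integral (linepath b c) g
      - contour_integral (linepath d c) g - contour_integral (linepath a d) g"
    by (subst rev[of c d], subst rev[of d a]) simp
  finally show ?thesis by (simp add: h_def v_def abcd right_of_def top_of_def)
qed


text \<open>Summed over the squares of a fine grid that meet \<open>K\<close>, Cauchy's formula leaves only
  edges with exactly one adjacent square meeting \<open>K\<close>; these avoid \<open>K\<close>.  Points of \<open>K\<close> on grid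
  lines are reached by continuity.\<close>

theorem holomorphic_in_uniform_span:
  assumes K: "compact K" and U: "open U" "K \<subseteq> U" and f: "f holomorphic_on U"
    and kernel: "\<And>w. w \<notin> K \<Longrightarrow> (\<lambda>s. 1 / (s - w)) \<in> uniform_span K B"
  shows "f \<in> uniform_span K B"
proof -
  obtain e where e: "e > 0" "(\<Union>x\<in>K. ball x e) \<subseteq> U"
    using compact_subset_open_imp_ball_epsilon_subset[OF K U] by blast
  \<comment> \<open>Two points of one square are at distance at most 2 \<delta> < e, so every square
    that meets K lies in U.\<close>
  define \<delta> where "\<delta> = e / 3"
  have \<delta>: "\<delta> > 0" using e by (simp add: \<delta>_def)
  define p where "p = grid_point \<delta>"
  define Q where "Q = grid_square \<delta>"
  define S where "S = {x. Q x \<inter> K \<noteq> {}}"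
  have finS: "finite S"
    unfolding S_def Q_def using finite_grid_squares_meeting[OF \<delta> compact_imp_bounded[OF K]] .
  have QU: "Q x \<subseteq> U" if xS: "x \<in> S" for x
  proof
    fix z assume z: "z \<in> Q x"
    obtain y where y: "y \<in> Q x" "y \<in> K" using xS by (auto simp: S_def)
    have "\<bar>Re (y - z)\<bar> \<le> \<delta>" "\<bar>Im (y - z)\<bar> \<le> \<delta>"
      using y(1) z by (auto simp: Q_def mem_grid_square distrib_left)
    then have "norm (y - z) \<le> \<delta> + \<delta>" using cmod_le[of "y - z"] by linarith
    also have "\<dots> < e" using e by (simp add: \<delta>_def)
    finally have "z \<in> ball y e" by (simp add: dist_norm)
    then show "z \<in> U" using e(2) y(2) by blast
  qed
  have contf: "continuous_on A f" if "A \<subseteq> U" for A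
    using holomorphic_on_imp_continuous_on[OF f] that continuous_on_subset by blast
  define H where "H x = closed_segment (p x) (p (right_of x))" for x
  define V where "V x = closed_segment (p x) (p (top_of x))" for x
  have edges: "H x \<subseteq> Q x" "H (top_of x) \<subseteq> Q x" "V x \<subseteq> Q x" "V (right_of x) \<subseteq> Q x" for x
    using grid_edges_subset_square[OF \<delta>, of x] by (simp_all add: H_def V_def Q_def p_def)
  \<comment> \<open>Net multiplicities of the edges based at x: a horizontal edge counts +1 as the
    bottom of the square x and -1 as the top of the square below, a vertical edge +1 for the square
    x and -1 for the square to its left. An edge that meets K has both its squares in S and gets
    0.\<close>
  define ch cv :: "int \<times> int \<Rightarrow> complex"
    where "ch x = of_bool (x \<in> S) - of_bool (x \<in> top_of ` S)"
      and "cv x = of_bool (x \<in> S) - of_bool (x \<in> right_of ` S)" for x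
  have disj: "H x \<inter> K = {}" if "ch x \<noteq> 0" for x
  proof (rule ccontr)
    assume "H x \<inter> K \<noteq> {}"
    then obtain z where z: "z \<in> H x" "z \<in> K" by blast
    define y where "y = (fst x, snd x - 1)"
    have xy: "x = top_of y" by (simp add: y_def top_of_def)
    have "z \<in> Q x" using edges(1) z(1) by blast
    moreover have "z \<in> Q y" using edges(2)[of y] z(1) unfolding xy by blast
    ultimately have "x \<in> S" "y \<in> S" using z(2) unfolding S_def by blast+
    moreover from this have "x \<in> top_of ` S" using xy by blast
    ultimately have "ch x = 0" by (simp add: ch_def)
    with that show False by simp
  qed
  have disj': "V x \<inter> K = {}" if "cv x \<noteq> 0" for x
  proof (rule ccontr)
    assume "V x \<inter> K \<noteq> {}"
    then obtain z where z: "z \<in> V x" "z \<in> K" by blast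
    define y where "y = (fst x - 1, snd x)"
    have xy: "x = right_of y" by (simp add: y_def right_of_def)
    have "z \<in> Q x" using edges(3) z(1) by blast
    moreover have "z \<in> Q y" using edges(4)[of y] z(1) unfolding xy by blast
    ultimately have "x \<in> S" "y \<in> S" using z(2) unfolding S_def by blast+
    moreover from this have "x \<in> right_of ` S" using xy by blast
    ultimately have "cv x = 0" by (simp add: cv_def)
    with that show False by simp
  qed
  have HU: "H x \<subseteq> U" if "x \<in> S \<union> top_of ` S" for x
    using that QU edges(1,2) by blast
  have VU: "V x \<subseteq> U" if "x \<in> S \<union> right_of ` S" for x
    using that QU edges(3,4) by blast
  define h where "h x s = contour_integral (linepath (p x) (p (right_of x))) (\<lambda>w. f w / (w - s))" for x s
  define v where "v x s = contour_integral (linepath (p x) (p (top_of x))) (\<lambda>w. f w / (w - s))" for x s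
  define \<Phi> where "\<Phi> s = (\<Sum>x\<in>S \<union> top_of ` S. ch x * h x s) - (\<Sum>x\<in>S \<union> right_of ` S. cv x * v x s)" for s
  define \<Gamma> where "\<Gamma> x = rectpath (p x) (p (right_of (top_of x)))" for x
  have \<Gamma>: "path_image (\<Gamma> x) = Q x - box (p x) (p (right_of (top_of x)))" "path_image (\<Gamma> x) \<subseteq> Q x" for x
    using path_image_rectpath_cbox_minus_box[of "p x" "p (right_of (top_of x))"] \<delta>
    by (auto simp: \<Gamma>_def Q_def p_def grid_square_def grid_defs mult_left_mono)
  \<comment> \<open>In the open square of \<open>x0\<close> the point s avoids all grid lines:
    Cauchy's formula applies to that square, Cauchy's theorem to all others.\<close>
  have formula: "\<Phi> s = 2 * pi * \<i> * f s"
    if x0: "x0 \<in> S" and s: "s \<in> box (p x0) (p (right_of (top_of x0)))" for x0 s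
  proof -
    have s': "\<delta> * fst x0 < Re s" "Re s < \<delta> * (fst x0 + 1)" "\<delta> * snd x0 < Im s" "Im s < \<delta> * (snd x0 + 1)"
      using s by (auto simp: p_def grid_defs in_box_complex_iff)
    have other: "s \<notin> Q x" if "x \<noteq> x0" for x
    proof
      assume "s \<in> Q x"
      then have "\<delta> * fst x < \<delta> * (fst x0 + 1)" "\<delta> * fst x0 < \<delta> * (fst x + 1)"
        "\<delta> * snd x < \<delta> * (snd x0 + 1)" "\<delta> * snd x0 < \<delta> * (snd x + 1)"
        using s' unfolding Q_def mem_grid_square by linarith+
      then have "fst x = fst x0" "snd x = snd x0"
        using \<delta> by (simp_all add: mult_less_cancel_left_pos)
      with that show False by (simp add: prod_eq_iff)
    qed
    have off: "s \<notin> path_image (\<Gamma> x)" for x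
      using \<Gamma>[of x] other[of x] s by (cases "x = x0") auto
    have square: "contour_integral (\<Gamma> x) (\<lambda>w. f w / (w - s)) = (if x = x0 then 2 * pi * \<i> * f s else 0)"
      if x: "x \<in> S" for x
    proof (cases "x = x0")
      case True
      have "((\<lambda>w. f w / (w - s)) has_contour_integral 2 * pi * \<i> * winding_number (\<Gamma> x) s * f s) (\<Gamma> x)"
      proof (rule Cauchy_integral_formula_convex_simple[of "Q x"])
        show "f holomorphic_on Q x" using f QU[OF x] by (rule holomorphic_on_subset)
        show "s \<in> interior (Q x)" using s True by (simp add: Q_def grid_square_def p_def)
        show "path_image (\<Gamma> x) \<subseteq> Q x - {s}" using \<Gamma>(2)[of x] off by blast
      qed (simp_all add: Q_def convex_grid_square \<Gamma>_def)
      moreover have "winding_number (\<Gamma> x) s = 1"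
        using winding_number_rectpath s True by (simp add: \<Gamma>_def)
      ultimately show ?thesis using True by (simp add: contour_integral_unique)
    next
      case False
      have "((\<lambda>w. f w / (w - s)) has_contour_integral 0) (\<Gamma> x)"
      proof (rule Cauchy_theorem_convex_simple[of _ "Q x"])
        show "(\<lambda>w. f w / (w - s)) holomorphic_on Q x"
          using holomorphic_on_subset[OF f QU[OF x]] other[OF False] by (intro holomorphic_intros) auto
      qed (use \<Gamma>(2) in \<open>simp_all add: Q_def convex_grid_square \<Gamma>_def\<close>)
      then show ?thesis using False by (simp add: contour_integral_unique)
    qed
    have "2 * pi * \<i> * f s = (\<Sum>x\<in>S. contour_integral (\<Gamma> x) (\<lambda>w. f w / (w - s)))"
      using finS x0 by (simp add: square cong: sum.cong)
    also have "\<dots> = (\<Sum>x\<in>S. (h x s - h (top_of x) s) - (v x s - v (right_of x) s))"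
    proof (rule sum.cong[OF refl])
      fix x assume x: "x \<in> S"
      have "continuous_on (path_image (\<Gamma> x)) (\<lambda>w. f w / (w - s))"
        using off[of x] \<Gamma>(2)[of x] QU[OF x] by (intro continuous_intros contf) auto
      then show "contour_integral (\<Gamma> x) (\<lambda>w. f w / (w - s)) = (h x s - h (top_of x) s) - (v x s - v (right_of x) s)"
        using contour_integral_grid_square[OF \<delta>] by (simp add: \<Gamma>_def p_def h_def v_def)
    qed
    also have "\<dots> = \<Phi> s"
      using sum_diff_shift[OF finS inj_top_of, of "\<lambda>x. h x s"] sum_diff_shift[OF finS inj_right_of, of "\<lambda>x. v x s"]
      by (simp add: sum_subtractf[of "\<lambda>x. h x s - h (top_of x) s"] \<Phi>_def ch_def cv_def)
    finally show ?thesis by simp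
  qed
  have eq: "\<Phi> s = 2 * pi * \<i> * f s" if s: "s \<in> K" for s
  proof -
    obtain x where x: "s \<in> Q x" using grid_square_exists[OF \<delta>] unfolding Q_def by blast
    then have xS: "x \<in> S" using s by (auto simp: S_def)
    define A where "A = box (p x) (p (right_of (top_of x)))"
    have "A \<noteq> {}" using \<delta> by (auto simp: A_def box_ne_empty p_def grid_defs Basis_complex_def)
    then have "s \<in> closure A" using x by (simp add: A_def Q_def grid_square_def p_def)
    then obtain y where y: "\<And>n. y n \<in> A" "y \<longlonglongrightarrow> s" unfolding closure_sequential by blast
    \<comment> \<open>An edge integral need not be continuous at points of its own edge, but an edge
      through s meets K and has coefficient 0.\<close>
    have "isCont (\<lambda>s. ch x * h x s) s" if "x \<in> S \<union> top_of ` S" for x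
    proof (cases "ch x = 0")
      case False
      then have "s \<notin> H x" using disj s by blast
      then show ?thesis unfolding h_def
        using HU[OF that] by (intro continuous_intros isCont_cauchy_line_integral contf) (auto simp: H_def)
    qed simp
    moreover have "isCont (\<lambda>s. cv x * v x s) s" if "x \<in> S \<union> right_of ` S" for x
    proof (cases "cv x = 0")
      case False
      then have "s \<notin> V x" using disj' s by blast
      then show ?thesis unfolding v_def
        using VU[OF that] by (intro continuous_intros isCont_cauchy_line_integral contf) (auto simp: V_def)
    qed simp
    ultimately have "isCont \<Phi> s"
      unfolding \<Phi>_def[abs_def] by (intro isCont_diff isCont_sum ballI)
    moreover have "isCont f s"
      using holomorphic_on_imp_continuous_on[OF f] U s continuous_on_eq_continuous_at by blast
    ultimately have "isCont (\<lambda>s. \<Phi> s - 2 * pi * \<i> * f s) s" by (intro continuous_intros)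
    then have "(\<lambda>n. \<Phi> (y n) - 2 * pi * \<i> * f (y n)) \<longlonglongrightarrow> \<Phi> s - 2 * pi * \<i> * f s"
      using y(2) by (rule isCont_tendsto_compose)
    moreover have "\<Phi> (y n) - 2 * pi * \<i> * f (y n) = 0" for n
      using formula[OF xS, of "y n"] y(1) by (simp add: A_def)
    ultimately have "(\<lambda>n. 0) \<longlonglongrightarrow> \<Phi> s - 2 * pi * \<i> * f s" by simp
    then show ?thesis by (simp add: LIMSEQ_const_iff)
  qed
  have ch_term: "(\<lambda>s. ch x * h x s) \<in> uniform_span K B" if "x \<in> S \<union> top_of ` S" for x
  proof (cases "ch x = 0")
    case False
    then show ?thesis unfolding h_def using disj[of x] HU[OF that]
      by (intro uniform_span_cmult cauchy_line_integral_in_uniform_span K kernel contf) (auto simp: H_def)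
  qed (simp add: uniform_span_zero)
  have cv_term: "(\<lambda>s. cv x * v x s) \<in> uniform_span K B" if "x \<in> S \<union> right_of ` S" for x
  proof (cases "cv x = 0")
    case False
    then show ?thesis unfolding v_def using disj'[of x] VU[OF that]
      by (intro uniform_span_cmult cauchy_line_integral_in_uniform_span K kernel contf) (auto simp: V_def)
  qed (simp add: uniform_span_zero)
  have "(\<lambda>s. \<Sum>x\<in>S \<union> top_of ` S. ch x * h x s) \<in> uniform_span K B"
    using ch_term by (rule uniform_span_sum)
  moreover have "(\<lambda>s. (-1) * (\<Sum>x\<in>S \<union> right_of ` S. cv x * v x s)) \<in> uniform_span K B"
    using cv_term by (intro uniform_span_cmult[of "\<lambda>s. \<Sum>x\<in>S \<union> right_of ` S. cv x * v x s"] uniform_span_sum)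
  ultimately have "(\<lambda>s. (\<Sum>x\<in>S \<union> top_of ` S. ch x * h x s) + (-1) * (\<Sum>x\<in>S \<union> right_of ` S. cv x * v x s))
      \<in> uniform_span K B"
    by (rule uniform_span_add)
  then have "\<Phi> \<in> uniform_span K B" by (simp add: \<Phi>_def[abs_def])
  then have span: "(\<lambda>s. 1 / (2 * pi * \<i>) * \<Phi> s) \<in> uniform_span K B" by (rule uniform_span_cmult)
  have "norm (f s - 1 / (2 * pi * \<i>) * \<Phi> s) = 0" if "s \<in> K" for s
    unfolding eq[OF that] by simp
  then show ?thesis
    by (intro uniform_span_limit) (rule bexI[OF _ span], simp)
qed

subsection \<open>The approximation theorem\<close>

theorem theorem6:
  fixes k :: "'a::field set" and \<zeta> :: "complex \<Rightarrow> complex"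
    and K :: "complex set" and f :: "complex \<Rightarrow> complex" and \<epsilon> :: real
  assumes "function_field_over_finite_field k"
    and "is_zeta_function k \<zeta>"
    and "compact K"
    and "\<exists>U. open U \<and> K \<subseteq> U \<and> f holomorphic_on U"
    and "\<epsilon> > 0"
  shows "\<exists>(n::nat) (a::nat \<Rightarrow> complex) (b::nat \<Rightarrow> complex) (l::nat \<Rightarrow> complex).
           \<forall>s\<in>K. (\<forall>j\<in>{1..n}. \<not> is_pole \<zeta> (a j * s + b j)) \<and>
                 norm (f s - (\<Sum>j=1..n. l j * \<zeta> (a j * s + b j))) < \<epsilon>"
proof -
  obtain U where U: "open U" "K \<subseteq> U" "f holomorphic_on U" using assms(4) by blast
  obtain z0 r where pole: "((\<lambda>t. t * \<zeta> (z0 + t)) \<longlongrightarrow> r) (at 0)" "r \<noteq> 0"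
    "eventually (\<lambda>z. \<not> is_pole \<zeta> z) (at z0)"
    using zeta_simple_pole[OF assms(1,2)] by metis
  \<comment> \<open>Absence of poles on K is built into B, so it holds for every term of an
    approximating combination.\<close>
  define B where "B = {\<lambda>s. \<zeta> (a * s + b) |a b. \<forall>s\<in>K. \<not> is_pole \<zeta> (a * s + b)}"
  have "(\<lambda>s. 1 / (s - w)) \<in> uniform_span K B" if w: "w \<notin> K" for w
  proof (rule uniform_span_limit)
    fix e :: real assume "e > 0"
    from approximate_simple_fraction[OF pole assms(3) w this] obtain a b l where
      abl: "\<And>s. s \<in> K \<Longrightarrow> \<not> is_pole \<zeta> (a * s + b)"
        "\<And>s. s \<in> K \<Longrightarrow> norm (1 / (s - w) - l * \<zeta> (a * s + b)) < e" by blast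
    have "(\<lambda>s. \<zeta> (a * s + b)) \<in> B" unfolding B_def using abl(1) by blast
    then have "(\<lambda>s. l * \<zeta> (a * s + b)) \<in> uniform_span K B"
      by (intro uniform_span_cmult uniform_span_base)
    then show "\<exists>h\<in>uniform_span K B. \<forall>s\<in>K. norm (1 / (s - w) - h s) < e"
      by (rule bexI[rotated]) (use abl(2) in blast)
  qed
  then have "f \<in> uniform_span K B"
    by (rule holomorphic_in_uniform_span[OF assms(3) U])
  then obtain xs where xs: "snd ` set xs \<subseteq> B" "\<forall>s\<in>K. norm (f s - (\<Sum>(c, b)\<leftarrow>xs. c * b s)) < \<epsilon>"
    using assms(5) unfolding uniform_span_def by blast
  have "\<exists>a b. snd (xs ! i) = (\<lambda>s. \<zeta> (a * s + b)) \<and> (\<forall>s\<in>K. \<not> is_pole \<zeta> (a * s + b))"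
    if "i < length xs" for i
  proof -
    have "snd (xs ! i) \<in> B" using xs(1) nth_mem[OF that] by blast
    then show ?thesis unfolding B_def by blast
  qed
  then obtain a b where ab: "\<And>i. i < length xs \<Longrightarrow> snd (xs ! i) = (\<lambda>s. \<zeta> (a i * s + b i))"
    "\<And>i s. i < length xs \<Longrightarrow> s \<in> K \<Longrightarrow> \<not> is_pole \<zeta> (a i * s + b i)"
    by metis
  \<comment> \<open>The shift j - 1 translates between list positions, which start at 0, and the
    summation range, which starts at 1.\<close>
  have sum: "(\<Sum>(c, b)\<leftarrow>xs. c * b s) =
      (\<Sum>j=1..length xs. fst (xs ! (j - 1)) * \<zeta> (a (j - 1) * s + b (j - 1)))" for s
    by (simp add: sum_list_sum_nth sum.atLeast1_atMost_eq atLeast0LessThan case_prod_beta ab(1))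
  have "\<not> is_pole \<zeta> (a (j - 1) * s + b (j - 1))" if "j \<in> {1..length xs}" "s \<in> K" for j s
    using that by (intro ab(2)) auto
  with xs(2) show ?thesis unfolding sum
    by (intro exI[where x = "length xs"] exI[where x = "\<lambda>j. a (j - 1)"]
        exI[where x = "\<lambda>j. b (j - 1)"] exI[where x = "\<lambda>j. fst (xs ! (j - 1))"]) blast
qed

end
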